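(* Consider the setting described in the context, and assume A1–A5. A sequence of alternatives $f_n=\sum_j\theta_{nj}\phi_j$ with $cn^{-r}\le\|f_n\|\le Cn^{-r}$ (constants $0<c<C$) is purely $n^{-r}$-consistent if and only if for every $\varepsilon>0$ there are $C_1=C_1(\varepsilon)$ and $n_0(\varepsilon)$ such that $$\sum_{j>C_1k_n}\theta_{nj}^2\le\varepsilon n^{-2r}\quad\text{for all }n>n_0(\varepsilon).$$
   Context: Fix $\sigma>0$, $0<r<1/2$ and an orthonormal basis $(\phi_j)_{j\ge1}$ of $\mathbb{L}_2(0,1)$. For each $n$ one observes $dY_n(t)=f(t)\,dt+\sigma n^{-1/2}dw(t)$, equivalently $y_j=\theta_j+\sigma n^{-1/2}\xi_j$, $\theta_j=\int_0^1f\phi_j$, $\xi_j$ i.i.d. $N(0,1)$; $H_0:f=0$. Weights $\kappa_{nj}^2\ge0$, $\rho_n=\sum_j\kappa_{nj}^2$, $T_n(Y_n)=\sum_j\kappa_{nj}^2y_j^2-\sigma^2n^{-1}\rho_n$, $k_n=\sup\{k:\sum_{j<k}\kappa_{nj}^2\le\rho_n/2\}$, $\kappa_n^2=\kappa_{nk_n}^2$. Assumptions: (A1) $j\mapsto\kappa_{nj}^2$ decreasing; (A2) $C_1<\sigma^{-4}n^2\sum_j\kappa_{nj}^4<C_2$; (A3) $c_1n^{-2r}\le\rho_n\le c_2n^{-2r}$; (A4) $\exists C_1>0,\lambda>1$: $\kappa^2_{n,[(1+\delta)k_n]}<C_1(1+\delta)^{-\lambda}\kappa_n^2$ for all $\delta>0,n$;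 (A5) $\kappa_{n1}^2\asymp\kappa_n^2$ and for each $c>1$ there is $C>0$ with $\kappa^2_{n,[ck_n]}\ge C\kappa_n^2$. A test generated by $T_n$ rejects $H_0$ iff $T_n$ exceeds a threshold. A (sub)sequence $f_{n_i}$ is consistent if for every $\alpha\in(0,1)$ and every sequence of tests $K_{n_i}$ generated by $T_{n_i}$ with $\alpha(K_{n_i})=\alpha(1+o(1))$, $\limsup_i\beta(K_{n_i},f_{n_i})<1-\alpha$; inconsistent if for every sequence of tests $K_{n_i}$ generated by $T_{n_i}$, $\liminf_i(\alpha(K_{n_i})+\beta(K_{n_i},f_{n_i}))\ge1$. A sequence $f_n$ is $n^{-r}$-consistent if it is consistent and $cn^{-r}<\|f_n\|<Cn^{-r}$ for some $0<c<C$. An $n^{-r}$-consistent sequence $f_n$ is purely $n^{-r}$-consistent if there is no subsequence $n_i\to\infty$ with $f_{n_i}=f_{1n_i}+f_{2n_i}$, where $f_{2n_i}$ is orthogonal to $f_{1n_i}$, $\|f_{2n_i}\|>c_1n_i^{-r}$ for some constant $c_1>0$, and $f_{2n_i}$ is inconsistent. *)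

theory Defs
  imports "HOL-Probability.Probability"
begin

text \<open>Sequence-space setting. Coefficients are indexed by j \<ge> 1 (index 0 is ignored).
  w n j stands for kappa_{nj}^2; a function th :: nat \<Rightarrow> real stands for the
  coefficient sequence (theta_j) of an alternative f = sum_j theta_j phi_j.\<close>

definition l2norm :: "(nat \<Rightarrow> real) \<Rightarrow> real" where
  "l2norm th = sqrt (\<Sum>\<^sub>\<infinity>j\<in>{1..}. (th j)\<^sup>2)"

definition in_l2 :: "(nat \<Rightarrow> real) \<Rightarrow> bool" where
  "in_l2 th \<longleftrightarrow> (\<lambda>j. (th j)\<^sup>2) summable_on {1..}"

definition rho :: "(nat \<Rightarrow> nat \<Rightarrow> real) \<Rightarrow> nat \<Rightarrow> real" where
  "rho w n = (\<Sum>\<^sub>\<infinity>j\<in>{1..}. w n j)"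

definition kn :: "(nat \<Rightarrow> nat \<Rightarrow> real) \<Rightarrow> nat \<Rightarrow> nat" where
  "kn w n = Sup {k. (\<Sum>j\<in>{1..<k}. w n j) \<le> rho w n / 2}"

definition kappa2 :: "(nat \<Rightarrow> nat \<Rightarrow> real) \<Rightarrow> nat \<Rightarrow> real" where
  "kappa2 w n = w n (kn w n)"

definition Xi :: "(nat \<Rightarrow> real) measure" where
  "Xi = PiM UNIV (\<lambda>_. density lborel std_normal_density)"

text \<open>Test statistic T_n evaluated at y_j = theta_j + sigma n^{-1/2} xi_j.\<close>
definition Tstat :: "real \<Rightarrow> (nat \<Rightarrow> nat \<Rightarrow> real) \<Rightarrow> nat \<Rightarrow> (nat \<Rightarrow> real) \<Rightarrow> (nat \<Rightarrow> real) \<Rightarrow> real" where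
  "Tstat \<sigma> w n th xi =
     (\<Sum>\<^sub>\<infinity>j\<in>{1..}. w n j * (th j + \<sigma> / sqrt (real n) * xi j)\<^sup>2) - \<sigma>\<^sup>2 / real n * rho w n"

definition alpha_err :: "real \<Rightarrow> (nat \<Rightarrow> nat \<Rightarrow> real) \<Rightarrow> nat \<Rightarrow> real \<Rightarrow> real" where
  "alpha_err \<sigma> w n t = measure Xi {xi \<in> space Xi. Tstat \<sigma> w n (\<lambda>_. 0) xi > t}"

definition beta_err :: "real \<Rightarrow> (nat \<Rightarrow> nat \<Rightarrow> real) \<Rightarrow> nat \<Rightarrow> real \<Rightarrow> (nat \<Rightarrow> real) \<Rightarrow> real" where
  "beta_err \<sigma> w n t th = measure Xi {xi \<in> space Xi. Tstat \<sigma> w n th xi \<le> t}"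

text \<open>s: strictly increasing subsequence n_i = s i; g i: alternative at sample size s i.\<close>
definition consistent ::
  "real \<Rightarrow> (nat \<Rightarrow> nat \<Rightarrow> real) \<Rightarrow> (nat \<Rightarrow> nat) \<Rightarrow> (nat \<Rightarrow> nat \<Rightarrow> real) \<Rightarrow> bool" where
  "consistent \<sigma> w s g \<longleftrightarrow>
     (\<forall>a::real. 0 < a \<and> a < 1 \<longrightarrow>
       (\<forall>t::nat \<Rightarrow> real.
          (\<lambda>i. alpha_err \<sigma> w (s i) (t i) / a) \<longlonglongrightarrow> 1 \<longrightarrow>
          limsup (\<lambda>i. ereal (beta_err \<sigma> w (s i) (t i) (g i))) < ereal (1 - a)))"

definition inconsistent ::
  "real \<Rightarrow> (nat \<Rightarrow> nat \<Rightarrow> real) \<Rightarrow> (nat \<Rightarrow> nat) \<Rightarrow> (nat \<Rightarrow> nat \<Rightarrow> real) \<Rightarrow> bool" where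
  "inconsistent \<sigma> w s g \<longleftrightarrow>
     (\<forall>t::nat \<Rightarrow> real.
        liminf (\<lambda>i. ereal (alpha_err \<sigma> w (s i) (t i) + beta_err \<sigma> w (s i) (t i) (g i))) \<ge> 1)"

definition rate_consistent ::
  "real \<Rightarrow> (nat \<Rightarrow> nat \<Rightarrow> real) \<Rightarrow> real \<Rightarrow> (nat \<Rightarrow> nat \<Rightarrow> real) \<Rightarrow> bool" where
  "rate_consistent \<sigma> w r f \<longleftrightarrow> consistent \<sigma> w id f \<and>
     (\<exists>c C. 0 < c \<and> c < C \<and>
        (\<forall>n\<ge>1. c * real n powr (-r) < l2norm (f n) \<and> l2norm (f n) < C * real n powr (-r)))"

definition purely_rate_consistent ::
  "real \<Rightarrow> (nat \<Rightarrow> nat \<Rightarrow> real) \<Rightarrow> real \<Rightarrow> (nat \<Rightarrow> nat \<Rightarrow> real) \<Rightarrow> bool" where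
  "purely_rate_consistent \<sigma> w r f \<longleftrightarrow> rate_consistent \<sigma> w r f \<and>
     \<not> (\<exists>s f1 f2 c1. strict_mono s \<and> 0 < c1 \<and>
          (\<forall>i. in_l2 (f1 i) \<and> in_l2 (f2 i) \<and>
               (\<forall>j. f (s i) j = f1 i j + f2 i j) \<and>
               (\<Sum>\<^sub>\<infinity>j\<in>{1..}. f1 i j * f2 i j) = 0 \<and>
               l2norm (f2 i) > c1 * real (s i) powr (-r)) \<and>
          inconsistent \<sigma> w s f2)"

end

theory Submission
  imports Defs
begin

text \<open>Multiply \<open>T\<^sub>n\<close> by the factor that gives it unit variance under the hypothesis. Under the
  alternative \<open>\<theta>\<close> it becomes \<open>S\<^sub>n + A\<^sub>n + R\<^sub>n\<close>, where \<open>S\<^sub>n\<close> is the standardised null statistic,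
  \<open>A\<^sub>n\<close> (the signal) is the rescaled sum of \<open>\<kappa>\<^sub>n\<^sub>j\<^sup>2 \<theta>\<^sub>j\<^sup>2\<close>, and the cross term \<open>R\<^sub>n\<close> has
  variance at most \<open>4 \<mu>\<^sub>n A\<^sub>n\<close>. Here \<open>\<mu>\<^sub>n\<close> is the largest standardised weight, which tends to 0;
  for the same reason \<open>S\<^sub>n\<close> is asymptotically standard normal, by estimating characteristic
  functions. Hence alternatives are consistent if the signal stays away from 0, and inconsistent
  exactly if the signal tends to 0.

  The standardised weights are of exact order \<open>n\<^sup>2\<^sup>r\<close> on \<open>j \<le> C k\<^sub>n\<close>, and beyond \<open>C k\<^sub>n\<close> they are at most
  a multiple of \<open>C\<^sup>-\<^sup>\<lambda> n\<^sup>2\<^sup>r\<close>. So if the tail condition fails, the tails of \<open>f\<^sub>n\<close> along a subsequence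
  are inconsistent. If it holds, the head of \<open>f\<^sub>n\<close> gives a signal bounded below, while the head of an
  inconsistent orthogonal part \<open>f\<^sub>2\<close> is negligible; the tail of \<open>f\<^sub>n\<close> being small as well,
  \<open>\<parallel>f\<^sub>2\<parallel>\<^sup>2 = \<langle>f, f\<^sub>2\<rangle>\<close> is too small for \<open>f\<^sub>2\<close> to be of order \<open>n\<^sup>-\<^sup>r\<close>.\<close>

section \<open>Gaussian sequences\<close>

lemma atLeast_Suc_0_eq_range_Suc: "{Suc 0..} = range Suc"
  by (auto simp: image_iff Suc_le_eq gr0_conv_Suc)

text \<open>The definitions use unordered sums over \<open>{1..}\<close>, while limits of partial
  sums concern ordered series. For nonnegative terms both notions of summability agree after the
  shift by \<open>Suc\<close>.\<close>

lemma summable_on_atLeast_Suc_0_iff: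
  fixes g :: "nat \<Rightarrow> real"
  assumes "\<And>j. 0 \<le> g j"
  shows "g summable_on {1..} \<longleftrightarrow> summable (\<lambda>j. g (Suc j))"
proof -
  have "g summable_on {1..} \<longleftrightarrow> (\<lambda>j. g (Suc j)) summable_on UNIV"
    using summable_on_reindex[of Suc UNIV g] by (simp add: atLeast_Suc_0_eq_range_Suc o_def)
  also have "\<dots> \<longleftrightarrow> summable (\<lambda>j. g (Suc j))"
    by (rule summable_on_UNIV_nonneg_real_iff) (rule assms)
  finally show ?thesis .
qed

lemma infsum_atLeast_Suc_0_sums:
  fixes g :: "nat \<Rightarrow> real"
  assumes "g summable_on {1..}"
  shows "(\<lambda>j. g (Suc j)) sums infsum g {1..}"
proof -
  have "(\<lambda>j. g (Suc j)) summable_on UNIV"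
    using assms summable_on_reindex[of Suc UNIV g] by (simp add: atLeast_Suc_0_eq_range_Suc o_def)
  hence "(\<lambda>j. g (Suc j)) sums infsum (\<lambda>j. g (Suc j)) UNIV"
    by (intro has_sum_imp_sums has_sum_infsum)
  moreover have "infsum g {1..} = infsum (\<lambda>j. g (Suc j)) UNIV"
    using infsum_reindex[of Suc UNIV g] by (simp add: atLeast_Suc_0_eq_range_Suc o_def)
  ultimately show ?thesis by simp
qed

text \<open>In the divergent case both sides are 0: the unordered sum by convention, the right side
  because \<open>enn2real\<close> sends infinity to 0. The right side is visibly measurable when the
  terms depend measurably on a parameter.\<close>

lemma infsum_atLeast_Suc_0_eq_enn2real:
  fixes g :: "nat \<Rightarrow> real"
  assumes "\<And>j. 0 \<le> g j"
  shows "infsum g {1..} = enn2real (\<Sum>j. ennreal (g (Suc j)))"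
proof (cases "summable (\<lambda>j. g (Suc j))")
  case True
  hence "g summable_on {1..}"
    using summable_on_atLeast_Suc_0_iff[of g, OF assms] by metis
  hence "infsum g {1..} = (\<Sum>j. g (Suc j))"
    using infsum_atLeast_Suc_0_sums sums_unique by blast
  moreover have "(\<Sum>j. ennreal (g (Suc j))) = ennreal (\<Sum>j. g (Suc j))"
    by (rule suminf_ennreal2) (rule assms, rule True)
  moreover have "0 \<le> (\<Sum>j. g (Suc j))"
    by (rule suminf_nonneg) (rule True, rule assms)
  ultimately show ?thesis by simp
next
  case False
  have "(\<Sum>j. ennreal (g (Suc j))) = \<top>"
    using False summable_suminf_not_top[of "\<lambda>j. g (Suc j)", OF assms] by metis
  moreover have "infsum g {1..} = 0"
    using summable_on_atLeast_Suc_0_iff[of g, OF assms] False by (metis infsum_not_exists)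
  ultimately show ?thesis by simp
qed

lemma prob_space_std_normal: "prob_space std_normal_distribution"
  using real_dist_normal_dist by (simp add: real_distribution_def)

interpretation std_normal: real_distribution std_normal_distribution
  by (rule real_dist_normal_dist)

interpretation Xi: prob_space Xi
  unfolding Xi_def by (intro prob_space_PiM prob_space_std_normal)

lemma sets_Xi [measurable_cong]: "sets Xi = sets (PiM UNIV (\<lambda>_. borel))"
  unfolding Xi_def by (intro sets_PiM_cong) auto

lemma space_Xi [simp]: "space Xi = UNIV"
  by (simp add: Xi_def space_PiM)

lemma distr_Xi_component: "distr Xi borel (\<lambda>xi. xi j) = std_normal_distribution"
proof -
  have "distr Xi borel (\<lambda>xi. xi j) = distr Xi std_normal_distribution (\<lambda>xi. xi j)"
    by (intro distr_cong) auto
  also have "\<dots> = std_normal_distribution"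
    unfolding Xi_def by (rule distr_PiM_component) (auto intro: prob_space_std_normal)
  finally show ?thesis .
qed

lemma indep_Xi_components: "Xi.indep_vars (\<lambda>_. borel) (\<lambda>j xi. xi j) UNIV"
proof (subst Xi.indep_vars_iff_distr_eq_PiM')
  have "distr Xi (PiM UNIV (\<lambda>_. borel)) (\<lambda>x. \<lambda>i\<in>UNIV. x i) = Xi"
    using distr_id2[OF sets_Xi[symmetric]] by (simp add: restrict_UNIV)
  thus "distr Xi (PiM UNIV (\<lambda>_. borel)) (\<lambda>x. \<lambda>i\<in>UNIV. x i) = 
     PiM UNIV (\<lambda>j. distr Xi borel (\<lambda>xi. xi j))"
    unfolding distr_Xi_component by (simp add: Xi_def)
qed simp_all

lemma indep_Xi_functions:
  assumes "\<And>j. g j \<in> borel_measurable borel"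
  shows "Xi.indep_vars (\<lambda>_. borel) (\<lambda>j xi. g j (xi j) :: real) A"
  by (rule Xi.indep_vars_subset[OF Xi.indep_vars_compose2[OF indep_Xi_components]]) (use assms in auto)

lemma
  assumes [measurable]: "g \<in> borel_measurable borel"
  shows integral_Xi_component: "(\<integral>xi. g (xi j) \<partial>Xi) = (\<integral>x. (g x :: real) \<partial>std_normal_distribution)"
    and integrable_Xi_component_iff: "integrable Xi (\<lambda>xi. g (xi j)) \<longleftrightarrow> integrable std_normal_distribution g"
proof -
  show "(\<integral>xi. g (xi j) \<partial>Xi) = (\<integral>x. (g x :: real) \<partial>std_normal_distribution)"
    by (subst distr_Xi_component[of j, symmetric], subst integral_distr) auto
  show "integrable Xi (\<lambda>xi. g (xi j)) \<longleftrightarrow> integrable std_normal_distribution g"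
    by (subst distr_Xi_component[of j, symmetric], subst integrable_distr_eq) auto
qed

text \<open>Rewriting through extended nonnegative reals covers every point, including those where
  the series diverges.\<close>

lemma Tstat_measurable [measurable]:
  assumes "\<And>j. 0 \<le> w n j"
  shows "Tstat \<sigma> w n th \<in> borel_measurable Xi"
proof -
  have "Tstat \<sigma> w n th = (\<lambda>xi. enn2real (\<Sum>j. ennreal (w n (Suc j) * (th (Suc j) + \<sigma> / sqrt (real n) * xi (Suc j))\<^sup>2))
      - \<sigma>\<^sup>2 / real n * rho w n)"
    unfolding Tstat_def by (subst infsum_atLeast_Suc_0_eq_enn2real) (use assms in auto)
  thus ?thesis by simp
qed

text \<open>By Tonelli the mean of the series is the sum of the weights, since each squared
  coordinate has mean 1; a nonnegative variable with finite mean is finite almost surely.\<close>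

lemma AE_weighted_squares_summable:
  fixes w :: "nat \<Rightarrow> real"
  assumes nn: "\<And>j. 0 \<le> w j" and sm: "w summable_on {1..}"
  shows "AE xi in Xi. (\<lambda>j. w j * (xi j)\<^sup>2) summable_on {1..}"
proof -
  have i1: "(\<integral>x. x\<^sup>2 \<partial>std_normal_distribution) = 1" 
    "integrable std_normal_distribution (\<lambda>x. x\<^sup>2)"
    using std_normal_distribution_even_moments[of 1] by auto
  have "(\<integral>\<^sup>+xi. (\<Sum>j. ennreal (w (Suc j) * (xi (Suc j))\<^sup>2)) \<partial>Xi)
      = (\<Sum>j. \<integral>\<^sup>+xi. ennreal (w (Suc j) * (xi (Suc j))\<^sup>2) \<partial>Xi)"
    by (intro nn_integral_suminf) auto
  also have "\<dots> = (\<Sum>j. ennreal (w (Suc j)))"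
  proof (intro suminf_cong)
    fix j
    have "integrable Xi (\<lambda>xi. w (Suc j) * (xi (Suc j))\<^sup>2)"
      using i1 by (intro integrable_mult_right) (auto simp: integrable_Xi_component_iff[of "\<lambda>x. x\<^sup>2"])
    hence "(\<integral>\<^sup>+xi. ennreal (w (Suc j) * (xi (Suc j))\<^sup>2) \<partial>Xi) = ennreal (\<integral>xi. w (Suc j) * (xi (Suc j))\<^sup>2 \<partial>Xi)"
      using nn by (intro nn_integral_eq_integral) auto
    also have "(\<integral>xi. w (Suc j) * (xi (Suc j))\<^sup>2 \<partial>Xi) = w (Suc j)"
      using i1 by (simp add: integral_Xi_component[of "\<lambda>x. x\<^sup>2"])
    finally show "(\<integral>\<^sup>+xi. ennreal (w (Suc j) * (xi (Suc j))\<^sup>2) \<partial>Xi) = ennreal (w (Suc j))" .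
  qed
  also have "\<dots> \<noteq> \<infinity>"
  proof -
    have "summable (\<lambda>j. w (Suc j))"
      using sm nn summable_on_atLeast_Suc_0_iff by blast
    thus ?thesis using nn by (simp add: suminf_ennreal2)
  qed
  finally have "AE xi in Xi. (\<Sum>j. ennreal (w (Suc j) * (xi (Suc j))\<^sup>2)) \<noteq> \<infinity>"
    by (intro nn_integral_noteq_infinite) auto
  thus ?thesis
  proof eventually_elim
    case (elim xi)
    have "summable (\<lambda>j. w (Suc j) * (xi (Suc j))\<^sup>2)"
      using elim nn by (intro summable_suminf_not_top) auto
    thus ?case using nn by (subst summable_on_atLeast_Suc_0_iff) auto
  qed
qed

lemma second_moment_weighted_sum:
  fixes b :: "nat \<Rightarrow> real"
  assumes "finite A"
  shows "integrable Xi (\<lambda>xi. (\<Sum>j\<in>A. b j * xi j)\<^sup>2)"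
    and "(\<integral>xi. (\<Sum>j\<in>A. b j * xi j)\<^sup>2 \<partial>Xi) = (\<Sum>j\<in>A. (b j)\<^sup>2)"
proof -
  have m: "(\<integral>x. x \<partial>std_normal_distribution) = 0" "integrable std_normal_distribution (\<lambda>x. x)"
    "(\<integral>x. x\<^sup>2 \<partial>std_normal_distribution) = 1" "integrable std_normal_distribution (\<lambda>x. x\<^sup>2)"
    using std_normal_distribution_even_moments[of 1] integral_std_normal_distribution_moment_odd[of 1]
      integrable_std_normal_distribution_moment[of 1] by auto
  have ic: "integrable Xi (\<lambda>xi. xi j)" "(\<integral>xi. xi j \<partial>Xi) = 0" for j
    using m(1,2) by (metis integrable_Xi_component_iff[OF measurable_ident, of j, unfolded id_def]
        integral_Xi_component[OF measurable_ident, of j, unfolded id_def])+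
  \<comment> \<open>The coordinates are orthonormal: for distinct indices independence factors the
    mean of the product into two zero means. After expanding the square only the diagonal
    survives.\<close>
  have cross: "integrable Xi (\<lambda>xi. xi i * xi j) \<and> (\<integral>xi. xi i * xi j \<partial>Xi) = (if i = j then 1 else 0)" for i j
  proof (cases "i = j")
    case True
    have "integrable Xi (\<lambda>xi. (xi j)\<^sup>2)" "(\<integral>xi. (xi j)\<^sup>2 \<partial>Xi) = 1"
      using m(3,4) by (subst integrable_Xi_component_iff integral_Xi_component; simp)+
    with True show ?thesis by (simp add: power2_eq_square)
  next
    case False
    have iv: "Xi.indep_vars (\<lambda>_. borel) (\<lambda>j xi. xi j) {i,j}"
      using Xi.indep_vars_subset[OF indep_Xi_components] by auto
    have "(\<integral>xi. (\<Prod>k\<in>{i,j}. xi k) \<partial>Xi) = (\<Prod>k\<in>{i,j}. \<integral>xi. xi k \<partial>Xi)"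
         "integrable Xi (\<lambda>xi. (\<Prod>k\<in>{i,j}. xi k))"
      by (intro Xi.indep_vars_lebesgue_integral Xi.indep_vars_integrable iv; simp add: ic)+
    with False show ?thesis by (simp add: ic)
  qed
  have eq: "(\<lambda>xi. (\<Sum>j\<in>A. b j * xi j)\<^sup>2) = (\<lambda>xi. \<Sum>i\<in>A. \<Sum>j\<in>A. (b i * b j) * (xi i * xi j))"
    by (simp add: power2_eq_square sum_product mult_ac)
  show "integrable Xi (\<lambda>xi. (\<Sum>j\<in>A. b j * xi j)\<^sup>2)"
    unfolding eq using cross by (intro Bochner_Integration.integrable_sum integrable_mult_right) auto
  have "(\<integral>xi. (\<Sum>j\<in>A. b j * xi j)\<^sup>2 \<partial>Xi) = (\<Sum>i\<in>A. \<Sum>j\<in>A. (b i * b j) * (if i = j then 1 else 0))"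
    unfolding eq by (simp add: cross)
  also have "\<dots> = (\<Sum>j\<in>A. (b j)\<^sup>2)"
    using assms by (simp add: power2_eq_square sum.delta if_distrib cong: if_cong)
  finally show "(\<integral>xi. (\<Sum>j\<in>A. b j * xi j)\<^sup>2 \<partial>Xi) = (\<Sum>j\<in>A. (b j)\<^sup>2)" .
qed

section \<open>Decomposition of the test statistic\<close>

text \<open>The factor 2 is the variance of \<open>\<xi>\<^sup>2 - 1\<close> for a standard normal \<open>\<xi>\<close>.\<close>

definition null_sd :: "(nat \<Rightarrow> nat \<Rightarrow> real) \<Rightarrow> nat \<Rightarrow> real" where
  "null_sd w n = sqrt (2 * (\<Sum>\<^sub>\<infinity>j\<in>{1..}. (w n j)\<^sup>2))"

text \<open>Under the hypothesis \<open>Tstat\<close> is \<open>\<sigma>\<^sup>2 / n\<close> times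
  the series of the \<open>w n j * (\<xi>\<^sub>j\<^sup>2 - 1)\<close>, whose standard deviation is
  \<open>null_sd\<close>; the factor is the reciprocal of the product.\<close>

definition std_factor :: "real \<Rightarrow> (nat \<Rightarrow> nat \<Rightarrow> real) \<Rightarrow> nat \<Rightarrow> real" where
  "std_factor \<sigma> w n = real n / (\<sigma>\<^sup>2 * null_sd w n)"

definition null_stat :: "real \<Rightarrow> (nat \<Rightarrow> nat \<Rightarrow> real) \<Rightarrow> nat \<Rightarrow> (nat \<Rightarrow> real) \<Rightarrow> real" where
  "null_stat \<sigma> w n xi = std_factor \<sigma> w n * Tstat \<sigma> w n (\<lambda>_. 0) xi"

definition signal :: "real \<Rightarrow> (nat \<Rightarrow> nat \<Rightarrow> real) \<Rightarrow> nat \<Rightarrow> (nat \<Rightarrow> real) \<Rightarrow> real" where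
  "signal \<sigma> w n th = std_factor \<sigma> w n * (\<Sum>\<^sub>\<infinity>j\<in>{1..}. w n j * (th j)\<^sup>2)"

text \<open>For decreasing weights the first is the largest. This ratio controls both the normal
  approximation of the null statistic and the variance of the cross term.\<close>

definition max_weight :: "(nat \<Rightarrow> nat \<Rightarrow> real) \<Rightarrow> nat \<Rightarrow> real" where
  "max_weight w n = w n 1 / null_sd w n"

text \<open>Almost surely this is the standardised series of the \<open>2 \<sigma> n\<^sup>-\<^sup>1\<^sup>/\<^sup>2 w\<^sub>j \<theta>\<^sub>j \<xi>\<^sub>j\<close>.
  Defining it as a remainder makes it measurable without a discussion of convergence.\<close>

definition cross_term :: "real \<Rightarrow> (nat \<Rightarrow> nat \<Rightarrow> real) \<Rightarrow> nat \<Rightarrow> (nat \<Rightarrow> real) \<Rightarrow> (nat \<Rightarrow> real) \<Rightarrow> real" where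
  "cross_term \<sigma> w n th xi = std_factor \<sigma> w n * Tstat \<sigma> w n th xi - null_stat \<sigma> w n xi - signal \<sigma> w n th"

lemma null_sd_sq: "(null_sd w n)\<^sup>2 = 2 * (\<Sum>\<^sub>\<infinity>j\<in>{1..}. (w n j)\<^sup>2)"
  unfolding null_sd_def by (subst real_sqrt_pow2) (auto intro!: infsum_nonneg)

lemma summable_on_weighted_squares:
  fixes u th :: "nat \<Rightarrow> real"
  assumes "\<And>j. 0 \<le> u j" "\<And>j. 1 \<le> j \<Longrightarrow> u j \<le> m" "in_l2 th"
  shows "(\<lambda>j. u j * (th j)\<^sup>2) summable_on {1..}"
proof (rule summable_on_comparison_test)
  show "(\<lambda>j. m * (th j)\<^sup>2) summable_on {1..}"
    using assms(3) unfolding in_l2_def by (rule summable_on_cmult_right)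
qed (use assms in \<open>auto intro: mult_right_mono\<close>)

text \<open>Expanding \<open>(\<theta> + c \<xi>)\<^sup>2\<close> and removing both pure squares
  leaves \<open>2 c \<theta> \<xi>\<close>. Almost surely the three series of squares converge, so
  the mixed series converges as a combination of them.\<close>

lemma AE_cross_term_tendsto:
  assumes nn: "\<And>j. 0 \<le> w n j" and sm: "w n summable_on {1..}"
    and le1: "\<And>j. 1 \<le> j \<Longrightarrow> w n j \<le> w n 1" and th: "in_l2 th"
  shows "AE xi in Xi. (\<lambda>N. \<Sum>j<N. (2 * std_factor \<sigma> w n * (\<sigma> / sqrt (real n)) * w n (Suc j) * th (Suc j)) * xi (Suc j))
           \<longlonglongrightarrow> cross_term \<sigma> w n th xi"
  using AE_weighted_squares_summable[of "w n", OF nn sm]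
proof eventually_elim
  case (elim xi)
  define c where "c = \<sigma> / sqrt (real n)"
  have s1: "(\<lambda>j. w n j * (th j)\<^sup>2) summable_on {1..}"
    by (rule summable_on_weighted_squares[OF nn le1 th])
  have s2: "(\<lambda>j. c\<^sup>2 * (w n j * (xi j)\<^sup>2)) summable_on {1..}"
    using elim by (rule summable_on_cmult_right)
  have s3: "(\<lambda>j. w n j * (th j + c * xi j)\<^sup>2) summable_on {1..}"
  proof (rule summable_on_comparison_test)
    show "(\<lambda>j. 2 * (w n j * (th j)\<^sup>2) + 2 * (c\<^sup>2 * (w n j * (xi j)\<^sup>2))) summable_on {1..}"
      by (intro summable_on_add summable_on_cmult_right s1 s2)
    fix j :: nat
    \<comment> \<open>The square of the difference is nonnegative, so the mixed product is dominated
      by the two pure squares, whose series converge.\<close>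
    have "(th j + c * xi j)\<^sup>2 \<le> 2 * (th j)\<^sup>2 + 2 * (c * xi j)\<^sup>2"
      using sum_squares_ge_zero[of "th j - c * xi j" 0] by (simp add: power2_eq_square algebra_simps)
    hence "w n j * (th j + c * xi j)\<^sup>2 \<le> w n j * (2 * (th j)\<^sup>2 + 2 * (c * xi j)\<^sup>2)"
      by (rule mult_left_mono) (rule nn)
    thus "w n j * (th j + c * xi j)\<^sup>2 \<le> 2 * (w n j * (th j)\<^sup>2) + 2 * (c\<^sup>2 * (w n j * (xi j)\<^sup>2))"
      by (simp add: algebra_simps power_mult_distrib)
    show "0 \<le> w n j * (th j + c * xi j)\<^sup>2" by (simp add: nn)
  qed
  have "(\<lambda>j. std_factor \<sigma> w n * (w n (Suc j) * (th (Suc j) + c * xi (Suc j))\<^sup>2)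
      - std_factor \<sigma> w n * (c\<^sup>2 * (w n (Suc j) * (xi (Suc j))\<^sup>2))
      - std_factor \<sigma> w n * (w n (Suc j) * (th (Suc j))\<^sup>2))
    sums (std_factor \<sigma> w n * (\<Sum>\<^sub>\<infinity>j\<in>{1..}. w n j * (th j + c * xi j)\<^sup>2)
      - std_factor \<sigma> w n * (\<Sum>\<^sub>\<infinity>j\<in>{1..}. c\<^sup>2 * (w n j * (xi j)\<^sup>2))
      - std_factor \<sigma> w n * (\<Sum>\<^sub>\<infinity>j\<in>{1..}. w n j * (th j)\<^sup>2))"
    by (intro sums_diff sums_mult infsum_atLeast_Suc_0_sums[OF s1] infsum_atLeast_Suc_0_sums[OF s2]
          infsum_atLeast_Suc_0_sums[OF s3])
  moreover have "(\<lambda>j. std_factor \<sigma> w n * (w n (Suc j) * (th (Suc j) + c * xi (Suc j))\<^sup>2)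
      - std_factor \<sigma> w n * (c\<^sup>2 * (w n (Suc j) * (xi (Suc j))\<^sup>2))
      - std_factor \<sigma> w n * (w n (Suc j) * (th (Suc j))\<^sup>2))
     = (\<lambda>j. (2 * std_factor \<sigma> w n * c * w n (Suc j) * th (Suc j)) * xi (Suc j))"
    by (auto simp: power2_eq_square algebra_simps)
  \<comment> \<open>The centring by \<open>rho\<close> occurs both in the statistic under the
    alternative and in the null statistic, and cancels.\<close>
  moreover have "(std_factor \<sigma> w n * (\<Sum>\<^sub>\<infinity>j\<in>{1..}. w n j * (th j + c * xi j)\<^sup>2)
      - std_factor \<sigma> w n * (\<Sum>\<^sub>\<infinity>j\<in>{1..}. c\<^sup>2 * (w n j * (xi j)\<^sup>2))
      - std_factor \<sigma> w n * (\<Sum>\<^sub>\<infinity>j\<in>{1..}. w n j * (th j)\<^sup>2)) = cross_term \<sigma> w n th xi"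
    unfolding cross_term_def null_stat_def signal_def Tstat_def c_def
    by (simp add: algebra_simps power_mult_distrib power_divide)
  ultimately have "(\<lambda>j. (2 * std_factor \<sigma> w n * c * w n (Suc j) * th (Suc j)) * xi (Suc j))
      sums cross_term \<sigma> w n th xi" by metis
  thus ?case unfolding sums_def c_def .
qed

lemma cross_term_measurable:
  assumes "\<And>j. 0 \<le> w n j"
  shows "cross_term \<sigma> w n th \<in> borel_measurable Xi"
proof -
  note [measurable] = Tstat_measurable[of w n, OF assms]
  show ?thesis unfolding cross_term_def[abs_def] null_stat_def by measurable
qed

text \<open>Chebyshev's inequality; the second moment of the partial sums passes to the limit by Fatou's
  lemma, and it is of this form because \<open>std_factor \<sigma> w n * \<sigma>\<^sup>2 / n = 1 / null_sd w n\<close>.\<close>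

lemma prob_cross_term_ge:
  assumes \<sigma>: "0 < \<sigma>" and n: "1 \<le> n" and D: "0 < null_sd w n"
    and nn: "\<And>j. 0 \<le> w n j" and sm: "w n summable_on {1..}"
    and le1: "\<And>j. 1 \<le> j \<Longrightarrow> w n j \<le> w n 1" and th: "in_l2 th" and \<eta>: "0 < \<eta>"
  shows "measure Xi {xi. \<bar>cross_term \<sigma> w n th xi\<bar> \<ge> \<eta>} \<le> 4 * max_weight w n * signal \<sigma> w n th / \<eta>\<^sup>2"
proof -
  define B where "B = 4 * max_weight w n * signal \<sigma> w n th"
  define c where "c = \<sigma> / sqrt (real n)"
  define b where "b j = 2 * std_factor \<sigma> w n * c * w n j * th j" for j
  note m [measurable] = cross_term_measurable[of w n \<sigma> th, OF nn]
  have q0: "0 < std_factor \<sigma> w n" unfolding std_factor_def using \<sigma> n D by auto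
  have qc: "std_factor \<sigma> w n * c\<^sup>2 = 1 / null_sd w n"
    unfolding std_factor_def c_def using \<sigma> n D by (simp add: power_divide field_simps)
  have s1: "(\<lambda>j. w n j * (th j)\<^sup>2) summable_on {1..}"
    by (rule summable_on_weighted_squares[OF nn le1 th])
  have B0: "0 \<le> B"
    unfolding B_def max_weight_def signal_def using q0 D nn
    by (intro mult_nonneg_nonneg divide_nonneg_nonneg infsum_nonneg) (auto intro: less_imp_le)
  \<comment> \<open>In each square one factor \<open>w n j\<close> is bounded by the largest weight
    and the other is kept. The kept factors build up the signal, so the bound is linear in it and
    uniform in \<open>N\<close>.\<close>
  have b2: "(\<Sum>j<N. (b (Suc j))\<^sup>2) \<le> B" for N
  proof -
    have "(b (Suc j))\<^sup>2 \<le> 4 * max_weight w n * std_factor \<sigma> w n * (w n (Suc j) * (th (Suc j))\<^sup>2)" for j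
    proof -
      have "(b (Suc j))\<^sup>2 = 4 * (std_factor \<sigma> w n * c\<^sup>2) * std_factor \<sigma> w n * (th (Suc j))\<^sup>2 * w n (Suc j) * w n (Suc j)"
        unfolding b_def by (simp add: power2_eq_square)
      also have "\<dots> = 4 / null_sd w n * std_factor \<sigma> w n * (th (Suc j))\<^sup>2 * w n (Suc j) * w n (Suc j)"
        unfolding qc by simp
      also have "\<dots> \<le> 4 / null_sd w n * std_factor \<sigma> w n * (th (Suc j))\<^sup>2 * w n (Suc j) * w n 1"
        using q0 D nn by (intro mult_left_mono le1) (auto intro!: mult_nonneg_nonneg less_imp_le)
      also have "\<dots> = 4 * max_weight w n * std_factor \<sigma> w n * (w n (Suc j) * (th (Suc j))\<^sup>2)"
        by (simp add: max_weight_def)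
      finally show ?thesis .
    qed
    hence "(\<Sum>j<N. (b (Suc j))\<^sup>2) \<le> (\<Sum>j<N. 4 * max_weight w n * std_factor \<sigma> w n * (w n (Suc j) * (th (Suc j))\<^sup>2))"
      by (intro sum_mono) auto
    also have "\<dots> = 4 * max_weight w n * std_factor \<sigma> w n * (\<Sum>j<N. w n (Suc j) * (th (Suc j))\<^sup>2)"
      by (simp add: sum_distrib_left)
    also have "\<dots> \<le> 4 * max_weight w n * std_factor \<sigma> w n * (\<Sum>\<^sub>\<infinity>j\<in>{1..}. w n j * (th j)\<^sup>2)"
    proof (intro mult_left_mono)
      show "(\<Sum>j<N. w n (Suc j) * (th (Suc j))\<^sup>2) \<le> (\<Sum>\<^sub>\<infinity>j\<in>{1..}. w n j * (th j)\<^sup>2)"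
        unfolding sums_unique[OF infsum_atLeast_Suc_0_sums[OF s1]]
        using infsum_atLeast_Suc_0_sums[OF s1] nn by (intro sum_le_suminf) (auto simp: sums_iff)
      show "0 \<le> 4 * max_weight w n * std_factor \<sigma> w n"
        unfolding max_weight_def using q0 D nn by (auto intro!: mult_nonneg_nonneg divide_nonneg_nonneg less_imp_le)
    qed
    finally show ?thesis by (simp add: B_def signal_def)
  qed
  have "(\<integral>\<^sup>+xi. ennreal ((cross_term \<sigma> w n th xi)\<^sup>2) \<partial>Xi)
      = (\<integral>\<^sup>+xi. liminf (\<lambda>N. ennreal ((\<Sum>j<N. b (Suc j) * xi (Suc j))\<^sup>2)) \<partial>Xi)"
  proof (rule nn_integral_cong_AE)
    show "AE xi in Xi. ennreal ((cross_term \<sigma> w n th xi)\<^sup>2)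
        = liminf (\<lambda>N. ennreal ((\<Sum>j<N. b (Suc j) * xi (Suc j))\<^sup>2))"
      using AE_cross_term_tendsto[of w n th \<sigma>, OF nn sm le1 th, simplified]
    proof eventually_elim
      case (elim xi)
      hence "(\<lambda>N. \<Sum>j<N. b (Suc j) * xi (Suc j)) \<longlonglongrightarrow> cross_term \<sigma> w n th xi"
        by (simp add: b_def c_def)
      hence "(\<lambda>N. ennreal ((\<Sum>j<N. b (Suc j) * xi (Suc j))\<^sup>2)) \<longlonglongrightarrow> ennreal ((cross_term \<sigma> w n th xi)\<^sup>2)"
        by (intro tendsto_ennrealI tendsto_power)
      from lim_imp_Liminf[OF _ this] show ?case by simp
    qed
  qed
  also have "\<dots> \<le> liminf (\<lambda>N. \<integral>\<^sup>+xi. ennreal ((\<Sum>j<N. b (Suc j) * xi (Suc j))\<^sup>2) \<partial>Xi)"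
    by (rule nn_integral_liminf) measurable
  also have "\<dots> \<le> limsup (\<lambda>N. ennreal B)"
  proof (rule order_trans[OF Liminf_le_Limsup Limsup_mono])
    show "\<forall>\<^sub>F N in sequentially. (\<integral>\<^sup>+xi. ennreal ((\<Sum>j<N. b (Suc j) * xi (Suc j))\<^sup>2) \<partial>Xi) \<le> ennreal B"
    proof (intro always_eventually allI)
      fix N
      have eq: "(\<Sum>j<N. b (Suc j) * xi (Suc j)) = (\<Sum>j\<in>Suc ` {..<N}. b j * xi j)" for xi
        by (subst sum.reindex) (auto simp: o_def)
      have "(\<integral>\<^sup>+xi. ennreal ((\<Sum>j<N. b (Suc j) * xi (Suc j))\<^sup>2) \<partial>Xi) = ennreal (\<Sum>j\<in>Suc ` {..<N}. (b j)\<^sup>2)"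
        unfolding eq by (subst nn_integral_eq_integral) (auto intro!: second_moment_weighted_sum simp: second_moment_weighted_sum)
      also have "(\<Sum>j\<in>Suc ` {..<N}. (b j)\<^sup>2) = (\<Sum>j<N. (b (Suc j))\<^sup>2)"
        by (subst sum.reindex) (auto simp: o_def)
      finally show "(\<integral>\<^sup>+xi. ennreal ((\<Sum>j<N. b (Suc j) * xi (Suc j))\<^sup>2) \<partial>Xi) \<le> ennreal B"
        using b2[of N] by (simp add: ennreal_leI)
    qed
  qed simp
  finally have E: "(\<integral>\<^sup>+xi. ennreal ((cross_term \<sigma> w n th xi)\<^sup>2) \<partial>Xi) \<le> ennreal B" by (simp add: Limsup_const)
  \<comment> \<open>Markov's inequality for the square, scaled so that the level becomes 1.\<close>
  have "emeasure Xi {xi\<in>space Xi. 1 \<le> ennreal (1 / \<eta>\<^sup>2) * ennreal ((cross_term \<sigma> w n th xi)\<^sup>2)}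
      \<le> ennreal (1 / \<eta>\<^sup>2) * (\<integral>\<^sup>+xi. ennreal ((cross_term \<sigma> w n th xi)\<^sup>2) \<partial>Xi)"
    using nn_integral_Markov_inequality[of "\<lambda>xi. ennreal ((cross_term \<sigma> w n th xi)\<^sup>2)" UNIV Xi "ennreal (1 / \<eta>\<^sup>2)"] m sets.top[of Xi]
    by simp
  also have "\<dots> \<le> ennreal (1 / \<eta>\<^sup>2) * ennreal B" by (intro mult_left_mono E) auto
  also have "\<dots> = ennreal (B / \<eta>\<^sup>2)" by (subst ennreal_mult[symmetric]) (auto simp: B0)
  also have "{xi\<in>space Xi. 1 \<le> ennreal (1 / \<eta>\<^sup>2) * ennreal ((cross_term \<sigma> w n th xi)\<^sup>2)}
     = {xi. \<bar>cross_term \<sigma> w n th xi\<bar> \<ge> \<eta>}"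
  proof -
    have "1 \<le> ennreal (1 / \<eta>\<^sup>2) * ennreal (x\<^sup>2) \<longleftrightarrow> \<eta> \<le> \<bar>x\<bar>" for x
    proof -
      have "1 \<le> ennreal (1 / \<eta>\<^sup>2) * ennreal (x\<^sup>2) \<longleftrightarrow> ennreal 1 \<le> ennreal (1 / \<eta>\<^sup>2 * x\<^sup>2)"
        by (subst ennreal_mult) auto
      also have "\<dots> \<longleftrightarrow> 1 \<le> 1 / \<eta>\<^sup>2 * x\<^sup>2" by (subst ennreal_le_iff) auto
      also have "\<dots> \<longleftrightarrow> \<eta>\<^sup>2 \<le> x\<^sup>2" using \<eta> by (simp add: field_simps)
      also have "\<dots> \<longleftrightarrow> \<eta> \<le> \<bar>x\<bar>" using \<eta> by (metis abs_le_square_iff abs_of_pos)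
      finally show ?thesis .
    qed
    thus ?thesis by simp
  qed
  finally have "emeasure Xi {xi. \<bar>cross_term \<sigma> w n th xi\<bar> \<ge> \<eta>} \<le> ennreal (B / \<eta>\<^sup>2)" .
  hence "measure Xi {xi. \<bar>cross_term \<sigma> w n th xi\<bar> \<ge> \<eta>} \<le> B / \<eta>\<^sup>2"
    using B0 by (simp add: Xi.emeasure_eq_measure)
  thus ?thesis by (simp add: B_def)
qed

section \<open>Asymptotic normality under the hypothesis\<close>

text \<open>The lower bound is convexity. The upper one follows from
  \<open>1 + u \<le> exp u\<close> and
  \<open>(1 - u + u\<^sup>2) * (1 + u) = 1 + u\<^sup>3\<close>.\<close>

lemma exp_minus_approx:
  fixes u :: real
  assumes "0 \<le> u"
  shows "\<bar>exp (- u) - (1 - u)\<bar> \<le> u\<^sup>2"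
proof -
  have "1 - u \<le> exp (- u)" using exp_ge_add_one_self[of "- u"] by simp
  moreover have "exp (- u) \<le> 1 - u + u\<^sup>2"
  proof -
    have "1 \<le> (1 - u + u\<^sup>2) * (1 + u)"
      using assms by (simp add: algebra_simps power2_eq_square)
    also have "\<dots> \<le> (1 - u + u\<^sup>2) * exp u"
    proof (rule mult_left_mono)
      have "0 \<le> (1 - u)\<^sup>2" "0 \<le> u\<^sup>2" by auto
      thus "0 \<le> 1 - u + u\<^sup>2" using assms by (simp add: power2_eq_square algebra_simps)
    qed simp
    finally show ?thesis by (simp add: exp_minus field_simps)
  qed
  ultimately show ?thesis by linarith
qed

definition char_centered_chi2 :: "real \<Rightarrow> complex" where
  "char_centered_chi2 = char (distr std_normal_distribution borel (\<lambda>x. x\<^sup>2 - 1))"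

lemma norm_char_centered_chi2_le_1: "norm (char_centered_chi2 t) \<le> 1"
  unfolding char_centered_chi2_def
  by (intro real_distribution.cmod_char_le_1) (auto intro!: std_normal.real_distribution_distr)

text \<open>The variable \<open>\<xi>\<^sup>2 - 1\<close> has mean 0 and variance 2, so its
  characteristic function agrees with \<open>exp (- s\<^sup>2)\<close> to second order. The third
  absolute moment controls the remainder near 0; away from 0 both functions are bounded by
  1.\<close>

lemma char_centered_chi2_approx:
  obtains K where "0 \<le> K"
    "\<And>s. norm (char_centered_chi2 s - complex_of_real (exp (- s\<^sup>2))) \<le> K * \<bar>s\<bar> ^ 3"
proof
  let ?N = std_normal_distribution
  define X where "X x = x\<^sup>2 - 1" for x :: real
  define M where "M = (\<integral>x. \<bar>X x\<bar> ^ 3 \<partial>?N)"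
  have [measurable]: "X \<in> borel_measurable borel" unfolding X_def by measurable
  have mo: "integrable ?N (\<lambda>x. x ^ k)" for k
    by (rule integrable_std_normal_distribution_moment)
  have e2: "(\<integral>x. x ^ 2 \<partial>?N) = 1" and e4: "(\<integral>x. x ^ 4 \<partial>?N) = 3"
    using std_normal_distribution_even_moments(1)[of 1] std_normal_distribution_even_moments(1)[of 2]
    by (auto simp: fact_numeral)
  have i1: "integrable ?N X" unfolding X_def by (intro Bochner_Integration.integrable_diff mo) auto
  have X2: "(X x)\<^sup>2 = x ^ 4 - 2 * x ^ 2 + 1" for x
    unfolding X_def by (simp add: power2_eq_square power4_eq_xxxx algebra_simps)
  have i2: "integrable ?N (\<lambda>x. (X x)\<^sup>2)"
    unfolding X2 by (intro Bochner_Integration.integrable_diff Bochner_Integration.integrable_add integrable_mult_right mo) auto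
  have E1: "(\<integral>x. X x \<partial>?N) = 0"
    unfolding X_def using e2 mo[of 2] by (simp add: std_normal.prob_space[simplified])
  have E2: "(\<integral>x. (X x)\<^sup>2 \<partial>?N) = 2"
    unfolding X2 using e2 e4 mo[of 2] mo[of 4] by (simp add: std_normal.prob_space[simplified])
  have i3: "integrable ?N (\<lambda>x. \<bar>X x\<bar> ^ 3)"
  proof (rule Bochner_Integration.integrable_bound)
    show "integrable ?N (\<lambda>x. x ^ 6 + 3 * x ^ 4 + 3 * x ^ 2 + 1)"
      by (intro Bochner_Integration.integrable_add integrable_mult_right mo) auto
    show "AE x in ?N. norm (\<bar>X x\<bar> ^ 3) \<le> norm (x ^ 6 + 3 * x ^ 4 + 3 * x ^ 2 + 1)"
    proof (rule AE_I2)
      fix x :: real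
      have "\<bar>X x\<bar> ^ 3 \<le> (x\<^sup>2 + 1) ^ 3"
        unfolding X_def by (intro power_mono) (auto simp: abs_le_iff)
      also have "\<dots> = x ^ 6 + 3 * x ^ 4 + 3 * x ^ 2 + 1"
        by (simp add: power3_eq_cube power2_eq_square eval_nat_numeral algebra_simps)
      finally show "norm (\<bar>X x\<bar> ^ 3) \<le> norm (x ^ 6 + 3 * x ^ 4 + 3 * x ^ 2 + 1)" by simp
    qed
  qed (simp add: X_def)
  have M0: "0 \<le> M" unfolding M_def by (intro Bochner_Integration.integral_nonneg) auto
  \<comment> \<open>For \<open>\<bar>s\<bar> \<le> 1\<close> the two Taylor errors cost
    \<open>M / 6\<close> and 1; for larger \<open>\<bar>s\<bar>\<close> the trivial bound 2 is
    covered by the 3.\<close>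
  show "0 \<le> M / 6 + 3" using M0 by simp
  fix s :: real
  show "norm (char_centered_chi2 s - complex_of_real (exp (- s\<^sup>2))) \<le> (M / 6 + 3) * \<bar>s\<bar> ^ 3"
  proof (cases "\<bar>s\<bar> \<le> 1")
    case True
    have "norm (char_centered_chi2 s - (1 - s\<^sup>2 * 2 / 2)) \<le> (s\<^sup>2 / 6) * (\<integral>x. min (6 * (X x)\<^sup>2) (\<bar>s\<bar> * \<bar>X x\<bar> ^ 3) \<partial>?N)"
      unfolding char_centered_chi2_def
      using E1 E2 i1 i2 by (intro std_normal.char_approx3') (auto simp: X_def[abs_def])
    also have "\<dots> \<le> (s\<^sup>2 / 6) * (\<integral>x. \<bar>s\<bar> * \<bar>X x\<bar> ^ 3 \<partial>?N)"
    proof (intro mult_left_mono integral_mono)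
      show "integrable ?N (\<lambda>x. \<bar>s\<bar> * \<bar>X x\<bar> ^ 3)" using i3 by simp
      show "integrable ?N (\<lambda>x. min (6 * (X x)\<^sup>2) (\<bar>s\<bar> * \<bar>X x\<bar> ^ 3))" using i2 i3 by simp
    qed auto
    also have "\<dots> = M / 6 * \<bar>s\<bar> ^ 3"
      by (simp add: M_def power3_eq_cube power2_eq_square abs_if)
    finally have 1: "norm (char_centered_chi2 s - complex_of_real (1 - s\<^sup>2)) \<le> M / 6 * \<bar>s\<bar> ^ 3" by simp
    have "norm (complex_of_real (1 - s\<^sup>2) - complex_of_real (exp (- s\<^sup>2))) = \<bar>exp (- s\<^sup>2) - (1 - s\<^sup>2)\<bar>"
      by (metis abs_minus_commute norm_of_real of_real_diff)
    also have "\<dots> \<le> (s\<^sup>2)\<^sup>2" by (rule exp_minus_approx) simp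
    also have "\<dots> = \<bar>s\<bar> ^ 3 * \<bar>s\<bar>" by (simp add: power3_eq_cube power2_eq_square abs_if)
    also have "\<dots> \<le> \<bar>s\<bar> ^ 3 * 1" using True by (intro mult_left_mono) auto
    finally have 2: "norm (complex_of_real (1 - s\<^sup>2) - complex_of_real (exp (- s\<^sup>2))) \<le> \<bar>s\<bar> ^ 3" by simp
    have "norm (char_centered_chi2 s - complex_of_real (exp (- s\<^sup>2))) \<le> M / 6 * \<bar>s\<bar> ^ 3 + \<bar>s\<bar> ^ 3"
      using norm_triangle_ineq[of "char_centered_chi2 s - complex_of_real (1 - s\<^sup>2)"
          "complex_of_real (1 - s\<^sup>2) - complex_of_real (exp (- s\<^sup>2))"] 1 2 by simp
    moreover have "0 \<le> \<bar>s\<bar> ^ 3" by simp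
    ultimately show ?thesis unfolding distrib_right by linarith
  next
    case False
    have "norm (char_centered_chi2 s - complex_of_real (exp (- s\<^sup>2)))
        \<le> norm (char_centered_chi2 s) + norm (complex_of_real (exp (- s\<^sup>2)))"
      by (rule norm_triangle_ineq4)
    also have "\<dots> \<le> 1 + 1" by (intro add_mono norm_char_centered_chi2_le_1) simp
    also have "\<dots> \<le> (M / 6 + 3) * 1" using M0 by simp
    also have "\<dots> \<le> (M / 6 + 3) * \<bar>s\<bar> ^ 3" using False M0 by (intro mult_left_mono) (auto simp: one_le_power)
    finally show ?thesis .
  qed
qed

lemma char_weighted_centered_chi2_sum:
  "char (distr Xi borel (\<lambda>xi. \<Sum>j<N. a j * ((xi (Suc j))\<^sup>2 - 1))) t = (\<Prod>j<N. char_centered_chi2 (t * a j))"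
proof -
  have "char (distr Xi borel (\<lambda>xi. \<Sum>j<N. a j * ((xi (Suc j))\<^sup>2 - 1))) t
      = char (distr Xi borel (\<lambda>xi. \<Sum>j\<in>Suc ` {..<N}. a (j - 1) * ((xi j)\<^sup>2 - 1))) t"
    by (subst sum.reindex) (auto simp: o_def)
  also have "\<dots> = (\<Prod>j\<in>Suc ` {..<N}. char (distr Xi borel (\<lambda>xi. a (j - 1) * ((xi j)\<^sup>2 - 1))) t)"
    by (intro Xi.char_distr_sum indep_Xi_functions[of "\<lambda>j x. a (j - 1) * (x\<^sup>2 - 1)"]) measurable
  also have "\<dots> = (\<Prod>j<N. char (distr Xi borel (\<lambda>xi. a j * ((xi (Suc j))\<^sup>2 - 1))) t)"
    by (subst prod.reindex) (auto simp: o_def)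
  also have "\<dots> = (\<Prod>j<N. char_centered_chi2 (t * a j))"
  proof (rule prod.cong[OF refl])
    fix j
    have "char (distr Xi borel (\<lambda>xi. a j * ((xi (Suc j))\<^sup>2 - 1))) t
       = char (distr (distr Xi borel (\<lambda>xi. xi (Suc j))) borel (\<lambda>x. a j * (x\<^sup>2 - 1))) t"
      by (subst distr_distr) (auto simp: o_def)
    also have "\<dots> = char_centered_chi2 (t * a j)"
      unfolding distr_Xi_component char_centered_chi2_def char_def
      by (subst integral_distr, simp, simp)+ (simp add: mult_ac)
    finally show "char (distr Xi borel (\<lambda>xi. a j * ((xi (Suc j))\<^sup>2 - 1))) t = char_centered_chi2 (t * a j)" .
  qed
  finally show ?thesis .
qed

lemma null_stat_measurable:
  assumes "\<And>j. 0 \<le> w n j"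
  shows "null_stat \<sigma> w n \<in> borel_measurable Xi"
proof -
  note [measurable] = Tstat_measurable[of w n, OF assms]
  show ?thesis unfolding null_stat_def[abs_def] by measurable
qed

text \<open>Since \<open>rho\<close> is the sum of the weights, the centring can be distributed over
  the terms of the series; \<open>\<sigma>\<close> and \<open>n\<close> cancel against
  \<open>std_factor\<close>.\<close>

lemma AE_null_stat_tendsto:
  assumes \<sigma>: "0 < \<sigma>" and n: "1 \<le> n" and D: "0 < null_sd w n"
    and nn: "\<And>j. 0 \<le> w n j" and sm: "w n summable_on {1..}"
  shows "AE xi in Xi. (\<lambda>N. \<Sum>j<N. w n (Suc j) / null_sd w n * ((xi (Suc j))\<^sup>2 - 1)) \<longlonglongrightarrow> null_stat \<sigma> w n xi"
  using AE_weighted_squares_summable[of "w n", OF nn sm]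
proof eventually_elim
  case (elim xi)
  have "(\<lambda>j. 1 / null_sd w n * (w n (Suc j) * (xi (Suc j))\<^sup>2 - w n (Suc j)))
     sums (1 / null_sd w n * ((\<Sum>\<^sub>\<infinity>j\<in>{1..}. w n j * (xi j)\<^sup>2) - (\<Sum>\<^sub>\<infinity>j\<in>{1..}. w n j)))"
    by (intro sums_mult sums_diff infsum_atLeast_Suc_0_sums[OF elim] infsum_atLeast_Suc_0_sums[OF sm])
  moreover have "(\<lambda>j. 1 / null_sd w n * (w n (Suc j) * (xi (Suc j))\<^sup>2 - w n (Suc j)))
      = (\<lambda>j. w n (Suc j) / null_sd w n * ((xi (Suc j))\<^sup>2 - 1))"
    by (auto simp: field_simps)
  moreover have "1 / null_sd w n * ((\<Sum>\<^sub>\<infinity>j\<in>{1..}. w n j * (xi j)\<^sup>2) - (\<Sum>\<^sub>\<infinity>j\<in>{1..}. w n j)) = null_stat \<sigma> w n xi"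
  proof -
    have "(\<Sum>\<^sub>\<infinity>j\<in>{1..}. w n j * (\<sigma> / sqrt (real n) * xi j)\<^sup>2) = (\<Sum>\<^sub>\<infinity>j\<in>{1..}. \<sigma>\<^sup>2 / real n * (w n j * (xi j)\<^sup>2))"
      using n by (intro infsum_cong) (simp add: power_mult_distrib power_divide)
    also have "\<dots> = \<sigma>\<^sup>2 / real n * (\<Sum>\<^sub>\<infinity>j\<in>{1..}. w n j * (xi j)\<^sup>2)"
      by (rule infsum_cmult_right) (rule elim)
    finally show ?thesis
      unfolding null_stat_def Tstat_def std_factor_def rho_def using \<sigma> n D
      by (simp add: field_simps)
  qed
  ultimately have "(\<lambda>j. w n (Suc j) / null_sd w n * ((xi (Suc j))\<^sup>2 - 1)) sums null_stat \<sigma> w n xi" by metis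
  thus ?case unfolding sums_def .
qed

text \<open>A Lindeberg comparison of products: each factor is replaced by
  \<open>exp (- (t * a\<^sub>j)\<^sup>2)\<close>. The standardised weights \<open>a\<^sub>j\<close>
  have squares with sum 1/2, so the Gaussian product tends to \<open>exp (- t\<^sup>2 / 2)\<close>.
  The error is at most \<open>K * \<bar>t\<bar>\<^sup>3\<close> times the sum of the cubes
  \<open>a\<^sub>j\<^sup>3\<close>, in each of which one factor is bounded by the maximum.\<close>

lemma char_null_stat_approx:
  assumes K: "0 \<le> K" "\<And>s. norm (char_centered_chi2 s - complex_of_real (exp (- s\<^sup>2))) \<le> K * \<bar>s\<bar> ^ 3"
    and \<sigma>: "0 < \<sigma>" and n: "1 \<le> n" and D: "0 < null_sd w n"
    and nn: "\<And>j. 0 \<le> w n j" and sm: "w n summable_on {1..}" and sm2: "(\<lambda>j. (w n j)\<^sup>2) summable_on {1..}"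
    and le1: "\<And>j. 1 \<le> j \<Longrightarrow> w n j \<le> w n 1"
  shows "norm (char (distr Xi borel (null_stat \<sigma> w n)) t - char std_normal_distribution t)
      \<le> K * \<bar>t\<bar> ^ 3 * max_weight w n"
proof -
  define a where "a j = w n (Suc j) / null_sd w n" for j
  define S where "S N xi = (\<Sum>j<N. a j * ((xi (Suc j))\<^sup>2 - 1))" for N and xi :: "nat \<Rightarrow> real"
  note [measurable] = null_stat_measurable[of w n, OF nn]
  have a0: "0 \<le> a j" and a1: "a j \<le> max_weight w n" for j
    unfolding a_def max_weight_def using nn D le1[of "Suc j"] by (auto intro: divide_right_mono)
  have asum: "(\<lambda>j. (a j)\<^sup>2) sums (1 / 2)"
  proof -
    have "(\<lambda>j. (w n (Suc j))\<^sup>2 / (null_sd w n)\<^sup>2) sums ((\<Sum>\<^sub>\<infinity>j\<in>{1..}. (w n j)\<^sup>2) / (null_sd w n)\<^sup>2)"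
      by (intro sums_divide infsum_atLeast_Suc_0_sums[OF sm2])
    moreover have "(\<Sum>\<^sub>\<infinity>j\<in>{1..}. (w n j)\<^sup>2) / (null_sd w n)\<^sup>2 = 1 / 2"
      using D null_sd_sq[of w n] by (auto simp: field_simps)
    ultimately have "(\<lambda>j. (w n (Suc j))\<^sup>2 / (null_sd w n)\<^sup>2) sums (1 / 2)" by metis
    thus ?thesis unfolding a_def power_divide .
  qed
  have [measurable]: "S N \<in> borel_measurable Xi" for N unfolding S_def by measurable
  have lim1: "(\<lambda>N. char (distr Xi borel (S N)) t) \<longlonglongrightarrow> char (distr Xi borel (null_stat \<sigma> w n)) t"
  proof -
    \<comment> \<open>Dominated convergence: the exponentials have modulus 1, so almost sure
      convergence of the partial sums suffices.\<close>
    have "(\<lambda>N. \<integral>xi. iexp (t * S N xi) \<partial>Xi) \<longlonglongrightarrow> (\<integral>xi. iexp (t * null_stat \<sigma> w n xi) \<partial>Xi)"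
    proof (rule integral_dominated_convergence[where w = "\<lambda>_. 1"])
      show "AE xi in Xi. (\<lambda>N. iexp (t * S N xi)) \<longlonglongrightarrow> iexp (t * null_stat \<sigma> w n xi)"
        using AE_null_stat_tendsto[of \<sigma> n w, OF \<sigma> n D nn sm]
      proof eventually_elim
        case (elim xi)
        hence "(\<lambda>N. S N xi) \<longlonglongrightarrow> null_stat \<sigma> w n xi" by (simp add: S_def a_def)
        thus ?case by (intro tendsto_intros)
      qed
    qed auto
    thus ?thesis unfolding char_def by (simp add: integral_distr)
  qed
  have lim2: "(\<lambda>N. complex_of_real (exp (- (t\<^sup>2 * (\<Sum>j<N. (a j)\<^sup>2))))) \<longlonglongrightarrow> char std_normal_distribution t"
  proof -
    have "(\<lambda>N. complex_of_real (exp (- (t\<^sup>2 * (\<Sum>j<N. (a j)\<^sup>2))))) \<longlonglongrightarrow> complex_of_real (exp (- (t\<^sup>2 * (1 / 2))))"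
      using asum unfolding sums_def by (intro tendsto_intros)
    thus ?thesis by (simp add: char_std_normal_distribution)
  qed
  have bd: "norm (char (distr Xi borel (S N)) t - complex_of_real (exp (- (t\<^sup>2 * (\<Sum>j<N. (a j)\<^sup>2)))))
       \<le> K * \<bar>t\<bar> ^ 3 * max_weight w n" for N
  proof -
    have "complex_of_real (exp (- (t\<^sup>2 * (\<Sum>j<N. (a j)\<^sup>2)))) = (\<Prod>j<N. complex_of_real (exp (- (t * a j)\<^sup>2)))"
      by (simp add: sum_distrib_left sum_negf[symmetric] exp_sum power_mult_distrib)
    hence "norm (char (distr Xi borel (S N)) t - complex_of_real (exp (- (t\<^sup>2 * (\<Sum>j<N. (a j)\<^sup>2)))))
       = norm ((\<Prod>j<N. char_centered_chi2 (t * a j)) - (\<Prod>j<N. complex_of_real (exp (- (t * a j)\<^sup>2))))"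
      unfolding S_def by (simp only: char_weighted_centered_chi2_sum)
    \<comment> \<open>For factors in the closed unit disc, two products differ by at most the sum of
      the differences of their factors.\<close>
    also have "\<dots> \<le> (\<Sum>j<N. norm (char_centered_chi2 (t * a j) - complex_of_real (exp (- (t * a j)\<^sup>2))))"
      by (intro norm_prod_diff norm_char_centered_chi2_le_1) simp
    also have "\<dots> \<le> (\<Sum>j<N. K * \<bar>t * a j\<bar> ^ 3)" by (intro sum_mono K)
    also have "\<dots> \<le> (\<Sum>j<N. K * \<bar>t\<bar> ^ 3 * max_weight w n * (a j)\<^sup>2)"
    proof (rule sum_mono)
      fix j
      have "K * \<bar>t * a j\<bar> ^ 3 = K * \<bar>t\<bar> ^ 3 * (a j)\<^sup>2 * a j"
        using a0[of j] by (simp add: abs_mult power3_eq_cube power2_eq_square)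
      also have "\<dots> \<le> K * \<bar>t\<bar> ^ 3 * (a j)\<^sup>2 * max_weight w n"
        using K(1) by (intro mult_left_mono a1) auto
      finally show "K * \<bar>t * a j\<bar> ^ 3 \<le> K * \<bar>t\<bar> ^ 3 * max_weight w n * (a j)\<^sup>2" by (simp add: mult_ac)
    qed
    also have "\<dots> = K * \<bar>t\<bar> ^ 3 * max_weight w n * (\<Sum>j<N. (a j)\<^sup>2)" by (simp add: sum_distrib_left)
    also have "\<dots> \<le> K * \<bar>t\<bar> ^ 3 * max_weight w n * 1"
    proof (rule mult_left_mono)
      have "(\<Sum>j<N. (a j)\<^sup>2) \<le> (\<Sum>j. (a j)\<^sup>2)" using asum by (intro sum_le_suminf) (auto simp: sums_iff)
      also have "\<dots> = 1 / 2" using asum by (simp add: sums_iff)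
      finally show "(\<Sum>j<N. (a j)\<^sup>2) \<le> 1" by simp
      show "0 \<le> K * \<bar>t\<bar> ^ 3 * max_weight w n" using K(1) a0[of 0] a1[of 0] by simp
    qed
    finally show ?thesis by simp
  qed
  show ?thesis
    by (rule LIMSEQ_le_const2[OF tendsto_norm[OF tendsto_diff[OF lim1 lim2]]]) (use bd in auto)
qed

section \<open>The normal distribution function and uniform convergence to it\<close>

abbreviation Phi :: "real \<Rightarrow> real" where
  "Phi \<equiv> cdf std_normal_distribution"

text \<open>The density is bounded by \<open>1 / sqrt (2 * pi)\<close>, hence by 1.\<close>

lemma Phi_diff_le: "x \<le> y \<Longrightarrow> Phi y - Phi x \<le> y - x"
proof (cases "x < y")
  case True
  have "emeasure std_normal_distribution {x<..y} = (\<integral>\<^sup>+z. ennreal (std_normal_density z) * indicator {x<..y} z \<partial>lborel)"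
    by (simp add: emeasure_density)
  also have "\<dots> \<le> (\<integral>\<^sup>+z. indicator {x<..y} z \<partial>lborel)"
  proof (rule nn_integral_mono)
    fix z :: real
    have "1 \<le> sqrt (2 * pi)" using pi_gt3 by simp
    hence "std_normal_density z \<le> 1"
      unfolding std_normal_density_def
      using mult_mono[of "1 / sqrt (2 * pi)" 1 "exp (- z\<^sup>2 / 2)" 1] by simp
    thus "ennreal (std_normal_density z) * indicator {x<..y} z \<le> indicator {x<..y} z"
      by (auto simp: indicator_def)
  qed
  also have "\<dots> = ennreal (y - x)" using True by simp
  finally have "measure std_normal_distribution {x<..y} \<le> y - x"
    using True by (simp add: std_normal.emeasure_eq_measure)
  thus ?thesis using std_normal.cdf_diff_eq[OF True] by simp
qed simp

text \<open>The density is positive everywhere, so an interval of normal measure 0 would be a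
  Lebesgue null set.\<close>

lemma Phi_strict_mono: "x < y \<Longrightarrow> Phi x < Phi y"
proof -
  assume xy: "x < y"
  have "emeasure std_normal_distribution {x<..y} \<noteq> 0"
  proof
    assume "emeasure std_normal_distribution {x<..y} = 0"
    hence "(\<integral>\<^sup>+z. ennreal (std_normal_density z) * indicator {x<..y} z \<partial>lborel) = 0"
      by (simp add: emeasure_density)
    hence "AE z in lborel. ennreal (std_normal_density z) * indicator {x<..y} z = 0"
      by (subst (asm) nn_integral_0_iff_AE) auto
    hence "AE z in lborel. z \<notin> {x<..y}"
    proof eventually_elim
      case (elim z)
      have "0 < std_normal_density z" by (rule normal_density_pos) simp
      thus ?case using elim by (auto simp: indicator_def)
    qed
    hence "emeasure lborel {x<..y} = 0" by (subst (asm) AE_iff_measurable[of "{x<..y}"]) auto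
    thus False using xy by simp
  qed
  hence "0 < measure std_normal_distribution {x<..y}"
    by (simp add: std_normal.emeasure_eq_measure zero_less_measure_iff)
  thus "Phi x < Phi y" using std_normal.cdf_diff_eq[OF xy] by simp
qed

lemma isCont_Phi: "isCont Phi x"
proof -
  have "\<bar>Phi y - Phi z\<bar> \<le> 1 * \<bar>y - z\<bar>" for y z
    using Phi_diff_le[of y z] Phi_diff_le[of z y] std_normal.cdf_nondecreasing[of y z]
      std_normal.cdf_nondecreasing[of z y] by (cases "y \<le> z") auto
  hence "1-lipschitz_on UNIV Phi" by (intro lipschitz_onI) (auto simp: dist_real_def)
  hence "continuous_on UNIV Phi" by (rule lipschitz_on_continuous_on)
  thus ?thesis by (simp add: continuous_on_eq_continuous_at)
qed

lemma Phi_quantile: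
  assumes "0 < p" "p < 1"
  obtains x where "Phi x = p"
proof -
  have "\<forall>\<^sub>F x in at_bot. Phi x < p"
    using order_tendstoD(2)[OF std_normal.cdf_lim_at_bot assms(1)] .
  then obtain x where x: "Phi x < p" using eventually_happens trivial_limit_at_bot_linorder by blast
  have "\<forall>\<^sub>F x in at_top. p < Phi x"
    using order_tendstoD(1)[OF std_normal.cdf_lim_at_top_prob assms(2)] .
  then obtain y where y: "p < Phi y" using eventually_happens trivial_limit_at_top_linorder by blast
  have "x \<le> y" using x y std_normal.cdf_nondecreasing[of y x] by linarith
  then obtain z where "Phi z = p" using IVT[of Phi x p y] x y isCont_Phi by auto
  thus thesis by (rule that)
qed

text \<open>Polya's theorem: pointwise convergence of distribution functions to a continuous
  limit is uniform, by comparison on finitely many quantiles.\<close>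

lemma cdf_tendsto_Phi_uniformly:
  fixes F :: "nat \<Rightarrow> real \<Rightarrow> real"
  assumes mono: "\<And>n x y. x \<le> y \<Longrightarrow> F n x \<le> F n y" and b: "\<And>n x. 0 \<le> F n x" "\<And>n x. F n x \<le> 1"
    and lim: "\<And>x. (\<lambda>n. F n x) \<longlonglongrightarrow> Phi x" and e: "0 < e"
  shows "\<forall>\<^sub>F n in sequentially. \<forall>x. \<bar>F n x - Phi x\<bar> \<le> e"
proof -
  \<comment> \<open>Neighbouring levels \<open>k / N\<close> differ by less than
    \<open>e / 2\<close>; the other half of \<open>e\<close> is left for the convergence at the
    quantiles.\<close>
  obtain N :: nat where N: "2 / e < real N" using reals_Archimedean2 by blast
  have "0 < 2 / e" using e by simp
  hence N0: "0 < N" using N by linarith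
  have Ne: "1 / real N < e / 2" using N N0 e by (simp add: field_simps)
  \<comment> \<open>Only levels strictly between 0 and 1 have quantiles; in the two extreme cells
    the bounds 0 and 1 on \<open>F\<close> take their place.\<close>
  have "\<exists>x. Phi x = real k / real N" if "k \<in> {1..<N}" for k
  proof -
    have "0 < real k / real N" "real k / real N < 1" using that by auto
    then obtain x where "Phi x = real k / real N" by (rule Phi_quantile)
    thus ?thesis by blast
  qed
  hence "\<forall>k\<in>{1..<N}. \<exists>x. Phi x = real k / real N" by blast
  from bchoice[OF this] obtain p where p: "\<And>k. k \<in> {1..<N} \<Longrightarrow> Phi (p k) = real k / real N" by blast
  have "\<forall>\<^sub>F n in sequentially. \<forall>k\<in>{1..<N}. dist (F n (p k)) (Phi (p k)) < e / 2"
    using lim e by (intro eventually_ball_finite ballI tendstoD) auto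
  thus ?thesis
  proof eventually_elim
    case (elim n)
    show ?case
    proof
      fix x
      \<comment> \<open>The cell from \<open>k / N\<close> to \<open>(k + 1) / N\<close> contains
        \<open>Phi x\<close>; monotonicity compares \<open>F n x\<close> with the values of
        \<open>F n\<close> at the two ends of the cell.\<close>
      define k where "k = nat \<lfloor>real N * Phi x\<rfloor>"
      have P0: "0 \<le> Phi x" by (rule std_normal.cdf_nonneg)
      have P1: "Phi x < 1"
        using Phi_strict_mono[of x "x + 1"] std_normal.cdf_bounded_prob[of "x + 1"] by linarith
      have k1: "real k \<le> real N * Phi x" and k2: "real N * Phi x < real k + 1"
        unfolding k_def using P0 N0 by (auto simp: of_nat_nat)
      have kN: "k < N"
      proof -
        have "real N * Phi x < real N * 1" using P1 N0 by (intro mult_strict_left_mono) auto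
        hence "real k < real N" using k1 by linarith
        thus ?thesis by simp
      qed
      have d1: "real k / real N \<le> Phi x" "Phi x < real k / real N + 1 / real N"
        using k1 k2 N0 by (auto simp: field_simps)
      have "Phi x - e \<le> F n x"
      proof (cases "k = 0")
        case True
        thus ?thesis using d1 Ne b(1)[of n x] e by simp
      next
        case False
        hence kk: "k \<in> {1..<N}" using kN by auto
        have "p k \<le> x" using Phi_strict_mono[of x "p k"] p[OF kk] d1(1) by (cases "p k \<le> x") auto
        hence "F n (p k) \<le> F n x" by (rule mono)
        moreover have "real k / real N - e / 2 < F n (p k)"
          using bspec[OF elim kk] p[OF kk] unfolding dist_real_def abs_less_iff by linarith
        ultimately show ?thesis using d1 Ne by linarith
      qed
      moreover have "F n x \<le> Phi x + e"
      proof (cases "Suc k < N")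
        case False
        hence "Suc k = N" using kN by simp
        hence "real k / real N + 1 / real N = 1" using N0 by (auto simp: field_simps)
        thus ?thesis using b(2)[of n x] d1 Ne e by linarith
      next
        case True
        hence kk: "Suc k \<in> {1..<N}" by auto
        have S: "Phi (p (Suc k)) = real k / real N + 1 / real N"
          using p[OF kk] by (simp add: add_divide_distrib add.commute)
        have "x \<le> p (Suc k)" using Phi_strict_mono[of "p (Suc k)" x] S d1(2) by (cases "x \<le> p (Suc k)") auto
        hence "F n x \<le> F n (p (Suc k))" by (rule mono)
        moreover have "F n (p (Suc k)) < Phi (p (Suc k)) + e / 2"
          using bspec[OF elim kk] unfolding dist_real_def abs_less_iff by linarith
        ultimately show ?thesis using d1 Ne S by linarith
      qed
      ultimately show "\<bar>F n x - Phi x\<bar> \<le> e" by linarith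
    qed
  qed
qed

section \<open>The null distribution and bounds for the error probabilities\<close>

definition null_cdf :: "real \<Rightarrow> (nat \<Rightarrow> nat \<Rightarrow> real) \<Rightarrow> nat \<Rightarrow> real \<Rightarrow> real" where
  "null_cdf \<sigma> w n x = measure Xi {xi. null_stat \<sigma> w n xi \<le> x}"

lemma null_cdf_eq_cdf:
  assumes "\<And>j. 0 \<le> w n j"
  shows "null_cdf \<sigma> w n = cdf (distr Xi borel (null_stat \<sigma> w n))"
proof
  fix x
  note [measurable] = null_stat_measurable[of w n, OF assms]
  show "null_cdf \<sigma> w n x = cdf (distr Xi borel (null_stat \<sigma> w n)) x"
    unfolding null_cdf_def cdf_def by (subst measure_distr) (auto simp: vimage_def)
qed

lemma null_cdf_mono:
  assumes "\<And>j. 0 \<le> w n j" "x \<le> y"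
  shows "null_cdf \<sigma> w n x \<le> null_cdf \<sigma> w n y"
proof -
  note [measurable] = null_stat_measurable[of w n, OF assms(1)]
  have "{xi \<in> space Xi. null_stat \<sigma> w n xi \<le> y} \<in> sets Xi" by measurable
  thus ?thesis unfolding null_cdf_def using assms(2)
    by (intro Xi.finite_measure_mono) auto
qed

text \<open>By Levy's continuity theorem, as the error in the characteristic function at a fixed
  \<open>t\<close> is a multiple of \<open>max_weight\<close>. The limit is continuous, so weak
  convergence holds at every point.\<close>

lemma null_cdf_tendsto_Phi:
  assumes \<sigma>: "0 < \<sigma>" and nn: "\<And>n j. 0 \<le> w n j" and D: "\<And>n. 1 \<le> n \<Longrightarrow> 0 < null_sd w n"
    and sm: "\<And>n. 1 \<le> n \<Longrightarrow> w n summable_on {1..}"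
    and sm2: "\<And>n. 1 \<le> n \<Longrightarrow> (\<lambda>j. (w n j)\<^sup>2) summable_on {1..}"
    and le1: "\<And>n j. 1 \<le> n \<Longrightarrow> 1 \<le> j \<Longrightarrow> w n j \<le> w n 1"
    and mu: "max_weight w \<longlonglongrightarrow> 0"
  shows "(\<lambda>n. null_cdf \<sigma> w n x) \<longlonglongrightarrow> Phi x"
proof -
  obtain K where K: "0 \<le> K" "\<And>s. norm (char_centered_chi2 s - complex_of_real (exp (- s\<^sup>2))) \<le> K * \<bar>s\<bar> ^ 3"
    using char_centered_chi2_approx by blast
  have m: "null_stat \<sigma> w n \<in> borel_measurable Xi" for n
    by (rule null_stat_measurable) (rule nn)
  have "weak_conv_m (\<lambda>n. distr Xi borel (null_stat \<sigma> w n)) std_normal_distribution"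
  proof (rule levy_continuity)
    show "real_distribution (distr Xi borel (null_stat \<sigma> w n))" for n
      by (intro Xi.real_distribution_distr m)
    show "real_distribution std_normal_distribution" by (rule real_dist_normal_dist)
    fix t
    show "(\<lambda>n. char (distr Xi borel (null_stat \<sigma> w n)) t) \<longlonglongrightarrow> char std_normal_distribution t"
    proof (rule Lim_null_comparison[THEN LIM_zero_cancel])
      show "\<forall>\<^sub>F n in sequentially. norm (char (distr Xi borel (null_stat \<sigma> w n)) t - char std_normal_distribution t)
           \<le> K * \<bar>t\<bar> ^ 3 * max_weight w n"
        using eventually_ge_at_top[of 1]
      proof eventually_elim
        case (elim n)
        show ?case
          by (rule char_null_stat_approx[OF K \<sigma> elim D[OF elim] nn sm[OF elim] sm2[OF elim] le1[OF elim]])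
      qed
      show "(\<lambda>n. K * \<bar>t\<bar> ^ 3 * max_weight w n) \<longlonglongrightarrow> 0"
        by (rule tendsto_mult_right_zero[OF mu])
    qed
  qed
  hence "(\<lambda>n. cdf (distr Xi borel (null_stat \<sigma> w n)) x) \<longlonglongrightarrow> Phi x"
    unfolding weak_conv_m_def weak_conv_def using isCont_Phi by blast
  thus ?thesis using null_cdf_eq_cdf[of w, OF nn] by simp
qed

lemma alpha_err_eq_null_cdf:
  assumes q: "0 < std_factor \<sigma> w n" and nn: "\<And>j. 0 \<le> w n j"
  shows "alpha_err \<sigma> w n t = 1 - null_cdf \<sigma> w n (std_factor \<sigma> w n * t)"
proof -
  note [measurable] = null_stat_measurable[of w n, OF nn]
  have "alpha_err \<sigma> w n t = Xi.prob (space Xi - {xi \<in> space Xi. null_stat \<sigma> w n xi \<le> std_factor \<sigma> w n * t})"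
    unfolding alpha_err_def null_stat_def using q by (intro arg_cong[where f = "measure Xi"]) auto
  also have "\<dots> = 1 - Xi.prob {xi \<in> space Xi. null_stat \<sigma> w n xi \<le> std_factor \<sigma> w n * t}"
    by (rule Xi.prob_compl) measurable
  finally show ?thesis by (simp add: null_cdf_def)
qed

text \<open>Acceptance means \<open>S + A + R \<le> q * t\<close>, with null statistic
  \<open>S\<close>, signal \<open>A\<close>, cross term \<open>R\<close> and standardising factor
  \<open>q\<close>. Off a Chebyshev event for \<open>R\<close> the signal merely shifts the argument
  of the null distribution function.\<close>

lemma
  assumes \<sigma>: "0 < \<sigma>" and n: "1 \<le> n" and D: "0 < null_sd w n"
    and nn: "\<And>j. 0 \<le> w n j" and sm: "w n summable_on {1..}"
    and le1: "\<And>j. 1 \<le> j \<Longrightarrow> w n j \<le> w n 1" and th: "in_l2 th" and \<delta>: "0 < \<delta>"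
  shows beta_err_le: "\<delta> \<le> signal \<sigma> w n th \<Longrightarrow>
      beta_err \<sigma> w n t th \<le> null_cdf \<sigma> w n (std_factor \<sigma> w n * t - \<delta> / 2) + 16 * max_weight w n / \<delta>"
    and beta_err_ge: "signal \<sigma> w n th \<le> \<delta> \<Longrightarrow>
      null_cdf \<sigma> w n (std_factor \<sigma> w n * t - 2 * \<delta>) - 4 * max_weight w n / \<delta> \<le> beta_err \<sigma> w n t th"
proof -
  define q where "q = std_factor \<sigma> w n"
  define A where "A = signal \<sigma> w n th"
  define R where "R = cross_term \<sigma> w n th"
  have q: "0 < q" unfolding q_def std_factor_def using \<sigma> n D by auto
  have mu: "0 \<le> max_weight w n" unfolding max_weight_def using nn D by auto
  have dec: "q * Tstat \<sigma> w n th xi = null_stat \<sigma> w n xi + A + R xi" for xi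
    by (simp add: q_def A_def R_def cross_term_def)
  have Tle: "Tstat \<sigma> w n th xi \<le> t \<longleftrightarrow> null_stat \<sigma> w n xi + A + R xi \<le> q * t" for xi
    unfolding dec[symmetric] using q by simp
  have M: "{xi. null_stat \<sigma> w n xi \<le> x} \<in> sets Xi" "{xi. x \<le> \<bar>R xi\<bar>} \<in> sets Xi"
     "{xi. Tstat \<sigma> w n th xi \<le> x} \<in> sets Xi" for x
  proof -
    note [measurable] = null_stat_measurable[of w n, OF nn] Tstat_measurable[of w n, OF nn]
      cross_term_measurable[of w n, OF nn]
    have "{xi\<in>space Xi. null_stat \<sigma> w n xi \<le> x} \<in> sets Xi" "{xi\<in>space Xi. x \<le> \<bar>R xi\<bar>} \<in> sets Xi"
     "{xi\<in>space Xi. Tstat \<sigma> w n th xi \<le> x} \<in> sets Xi"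
      unfolding R_def by measurable
    thus "{xi. null_stat \<sigma> w n xi \<le> x} \<in> sets Xi" "{xi. x \<le> \<bar>R xi\<bar>} \<in> sets Xi"
     "{xi. Tstat \<sigma> w n th xi \<le> x} \<in> sets Xi" by simp_all
  qed
  have PR: "measure Xi {xi. \<bar>R xi\<bar> \<ge> \<eta>} \<le> 4 * max_weight w n * A / \<eta>\<^sup>2" if "0 < \<eta>" for \<eta>
    unfolding R_def A_def by (rule prob_cross_term_ge[OF \<sigma> n D nn sm le1 th that])
  {
    assume le: "\<delta> \<le> signal \<sigma> w n th"
    hence A0: "0 < A" "\<delta> \<le> A" using \<delta> by (auto simp: A_def)
    \<comment> \<open>The Chebyshev level is \<open>A / 2\<close> rather than
      \<open>\<delta> / 2\<close>: the bound on the variance of \<open>R\<close> grows linearly with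
      \<open>A\<close>, so at this level the probability bound improves as \<open>A\<close>
      grows.\<close>
    have "beta_err \<sigma> w n t th \<le> measure Xi ({xi. null_stat \<sigma> w n xi \<le> q * t - \<delta> / 2} \<union> {xi. A / 2 \<le> \<bar>R xi\<bar>})"
      unfolding beta_err_def
    proof (rule Xi.finite_measure_mono)
      show "{xi \<in> space Xi. Tstat \<sigma> w n th xi \<le> t} \<subseteq> {xi. null_stat \<sigma> w n xi \<le> q * t - \<delta> / 2} \<union> {xi. A / 2 \<le> \<bar>R xi\<bar>}"
        unfolding Tle using A0 by auto
    qed (intro sets.Un M)
    also have "\<dots> \<le> measure Xi {xi. null_stat \<sigma> w n xi \<le> q * t - \<delta> / 2} + measure Xi {xi. A / 2 \<le> \<bar>R xi\<bar>}"
      by (rule measure_Un_le) (rule M)+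
    also have "\<dots> \<le> null_cdf \<sigma> w n (q * t - \<delta> / 2) + 4 * max_weight w n * A / (A / 2)\<^sup>2"
      unfolding null_cdf_def using PR[of "A / 2"] A0 by simp
    also have "4 * max_weight w n * A / (A / 2)\<^sup>2 = 16 * max_weight w n / A"
      using A0 by (simp add: power2_eq_square)
    also have "\<dots> \<le> 16 * max_weight w n / \<delta>"
      using A0 mu \<delta> by (intro divide_left_mono) auto
    finally show "beta_err \<sigma> w n t th \<le> null_cdf \<sigma> w n (std_factor \<sigma> w n * t - \<delta> / 2) + 16 * max_weight w n / \<delta>"
      by (simp add: q_def)
  next
    assume le: "signal \<sigma> w n th \<le> \<delta>"
    \<comment> \<open>From \<open>q * t - 2 * \<delta>\<close>, a signal of at most
      \<open>\<delta>\<close> and a cross term below \<open>\<delta>\<close> cannot reach past the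
      threshold.\<close>
    have "null_cdf \<sigma> w n (q * t - 2 * \<delta>) \<le> measure Xi ({xi. Tstat \<sigma> w n th xi \<le> t} \<union> {xi. \<delta> \<le> \<bar>R xi\<bar>})"
      unfolding null_cdf_def
    proof (rule Xi.finite_measure_mono)
      show "{xi. null_stat \<sigma> w n xi \<le> q * t - 2 * \<delta>} \<subseteq> {xi. Tstat \<sigma> w n th xi \<le> t} \<union> {xi. \<delta> \<le> \<bar>R xi\<bar>}"
        unfolding Tle using le by (auto simp: A_def)
    qed (intro sets.Un M)
    also have "\<dots> \<le> measure Xi {xi. Tstat \<sigma> w n th xi \<le> t} + measure Xi {xi. \<delta> \<le> \<bar>R xi\<bar>}"
      by (rule measure_Un_le) (rule M)+
    also have "\<dots> \<le> beta_err \<sigma> w n t th + 4 * max_weight w n * A / \<delta>\<^sup>2"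
      unfolding beta_err_def using PR[of \<delta>] \<delta> by simp
    also have "4 * max_weight w n * A / \<delta>\<^sup>2 \<le> 4 * max_weight w n * \<delta> / \<delta>\<^sup>2"
      using le mu by (intro divide_right_mono mult_left_mono) (auto simp: A_def)
    also have "\<dots> = 4 * max_weight w n / \<delta>" using \<delta> by (simp add: power2_eq_square)
    finally show "null_cdf \<sigma> w n (std_factor \<sigma> w n * t - 2 * \<delta>) - 4 * max_weight w n / \<delta> \<le> beta_err \<sigma> w n t th"
      by (simp add: q_def)
  }
qed

section \<open>Square summable sequences\<close>

lemma l2norm_sq: "(l2norm th)\<^sup>2 = (\<Sum>\<^sub>\<infinity>j\<in>{1..}. (th j)\<^sup>2)"
  unfolding l2norm_def by (subst real_sqrt_pow2) (auto intro!: infsum_nonneg)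

lemma summable_on_product_if_in_l2:
  assumes "in_l2 g" "in_l2 h"
  shows "(\<lambda>j. g j * h j) summable_on {1..}"
proof (rule summable_on_iff_abs_summable_on_real[THEN iffD2], rule Infinite_Sum.abs_summable_on_comparison_test')
  show "(\<lambda>j. (g j)\<^sup>2 + (h j)\<^sup>2) summable_on {1..}"
    using assms unfolding in_l2_def by (intro summable_on_add)
  fix j :: nat
  have "0 \<le> (\<bar>g j\<bar> - \<bar>h j\<bar>)\<^sup>2" by simp
  hence "2 * (\<bar>g j\<bar> * \<bar>h j\<bar>) \<le> (g j)\<^sup>2 + (h j)\<^sup>2" by (simp add: power2_diff)
  moreover have "0 \<le> \<bar>g j\<bar> * \<bar>h j\<bar>" by simp
  ultimately show "norm (g j * h j) \<le> (g j)\<^sup>2 + (h j)\<^sup>2"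
    unfolding real_norm_def abs_mult by linarith
qed

lemma infsum_head_tail:
  assumes "in_l2 th"
  shows "(\<Sum>\<^sub>\<infinity>j\<in>{1..}. (th j)\<^sup>2) = (\<Sum>\<^sub>\<infinity>j\<in>{j. j \<ge> 1 \<and> real j \<le> c}. (th j)\<^sup>2)
     + (\<Sum>\<^sub>\<infinity>j\<in>{j. j \<ge> 1 \<and> real j > c}. (th j)\<^sup>2)"
proof -
  have "{1..} = {j. j \<ge> 1 \<and> real j \<le> c} \<union> {j. j \<ge> 1 \<and> real j > c}" by auto
  moreover have "(\<Sum>\<^sub>\<infinity>j\<in>{j. j \<ge> 1 \<and> real j \<le> c} \<union> {j. j \<ge> 1 \<and> real j > c}. (th j)\<^sup>2)
     = (\<Sum>\<^sub>\<infinity>j\<in>{j. j \<ge> 1 \<and> real j \<le> c}. (th j)\<^sup>2) + (\<Sum>\<^sub>\<infinity>j\<in>{j. j \<ge> 1 \<and> real j > c}. (th j)\<^sup>2)"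
    using assms unfolding in_l2_def
    by (intro infsum_Un_disjoint) (auto elim!: summable_on_subset_banach)
  ultimately show ?thesis by simp
qed

text \<open>By orthogonality \<open>\<parallel>f2\<parallel>\<^sup>2\<close> is the inner product of \<open>f\<close> and \<open>f2\<close>, which is estimated
  by AM-GM with weight \<open>\<eta>\<close> on the head and weight 1 on the tail.\<close>

lemma orthogonal_part_norm_le:
  assumes l2: "in_l2 g" "in_l2 f1" "in_l2 f2" and dec: "\<And>j. g j = f1 j + f2 j"
    and orth: "(\<Sum>\<^sub>\<infinity>j\<in>{1..}. f1 j * f2 j) = 0" and \<eta>: "0 < \<eta>"
  shows "(\<Sum>\<^sub>\<infinity>j\<in>{1..}. (f2 j)\<^sup>2) \<le> \<eta> * (\<Sum>\<^sub>\<infinity>j\<in>{1..}. (g j)\<^sup>2)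
     + (\<Sum>\<^sub>\<infinity>j\<in>{j. j \<ge> 1 \<and> real j \<le> c}. (f2 j)\<^sup>2) / \<eta>
     + (\<Sum>\<^sub>\<infinity>j\<in>{j. j \<ge> 1 \<and> real j > c}. (g j)\<^sup>2)"
proof -
  let ?K = "{j::nat. j \<ge> 1 \<and> real j \<le> c}" and ?T = "{j::nat. j \<ge> 1 \<and> real j > c}"
  have s: "(\<lambda>j. (g j)\<^sup>2) summable_on {1..}" "(\<lambda>j. (f2 j)\<^sup>2) summable_on {1..}"
    using l2 by (auto simp: in_l2_def)
  \<comment> \<open>Head and tail terms are written as summands over all of \<open>{1..}\<close>
    that vanish elsewhere, so that one termwise comparison gives the whole estimate.\<close>
  have sK: "(\<lambda>j. if j \<in> ?K then (f2 j)\<^sup>2 / \<eta> else 0) summable_on {1..}"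
  proof (rule summable_on_comparison_test)
    show "(\<lambda>j. 1 / \<eta> * (f2 j)\<^sup>2) summable_on {1..}" by (rule summable_on_cmult_right[OF s(2)])
  qed (use \<eta> in auto)
  have sT: "(\<lambda>j. if j \<in> ?T then (g j)\<^sup>2 else 0) summable_on {1..}"
    by (rule summable_on_comparison_test[OF s(1)]) auto
  have sg: "(\<lambda>j. \<eta> * (g j)\<^sup>2) summable_on {1..}" by (rule summable_on_cmult_right[OF s(1)])
  have iK: "(\<Sum>\<^sub>\<infinity>j\<in>{1..}. if j \<in> ?K then (f2 j)\<^sup>2 / \<eta> else 0) = (\<Sum>\<^sub>\<infinity>j\<in>?K. (f2 j)\<^sup>2) / \<eta>"
  proof -
    have "(\<Sum>\<^sub>\<infinity>j\<in>{1..}. if j \<in> ?K then (f2 j)\<^sup>2 / \<eta> else 0) = (\<Sum>\<^sub>\<infinity>j\<in>?K. 1 / \<eta> * (f2 j)\<^sup>2)"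
      by (rule infsum_cong_neutral) auto
    also have "\<dots> = 1 / \<eta> * (\<Sum>\<^sub>\<infinity>j\<in>?K. (f2 j)\<^sup>2)"
      by (rule infsum_cmult_right) (rule summable_on_subset_banach[OF s(2)], auto)
    finally show ?thesis by simp
  qed
  have iT: "(\<Sum>\<^sub>\<infinity>j\<in>{1..}. if j \<in> ?T then (g j)\<^sup>2 else 0) = (\<Sum>\<^sub>\<infinity>j\<in>?T. (g j)\<^sup>2)"
    by (rule infsum_cong_neutral) auto
  \<comment> \<open>The identity is doubled: the estimate of \<open>2 * (g j * f2 j)\<close> leaves
    one copy of \<open>(f2 j)\<^sup>2\<close> on the right, which is subtracted at the end.\<close>
  have "(\<Sum>\<^sub>\<infinity>j\<in>{1..}. 2 * (f1 j * f2 j) + 2 * (f2 j)\<^sup>2) = 2 * (\<Sum>\<^sub>\<infinity>j\<in>{1..}. f1 j * f2 j) + 2 * (\<Sum>\<^sub>\<infinity>j\<in>{1..}. (f2 j)\<^sup>2)"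
    using s(2) summable_on_product_if_in_l2[OF l2(2,3)]
    by (subst infsum_add) (auto intro!: summable_on_cmult_right simp: infsum_cmult_right)
  hence "2 * (\<Sum>\<^sub>\<infinity>j\<in>{1..}. (f2 j)\<^sup>2) = (\<Sum>\<^sub>\<infinity>j\<in>{1..}. 2 * (f1 j * f2 j) + 2 * (f2 j)\<^sup>2)"
    using orth by simp
  also have "\<dots> \<le> (\<Sum>\<^sub>\<infinity>j\<in>{1..}. (f2 j)\<^sup>2 + \<eta> * (g j)\<^sup>2 + (if j \<in> ?K then (f2 j)\<^sup>2 / \<eta> else 0) + (if j \<in> ?T then (g j)\<^sup>2 else 0))"
  proof (rule infsum_mono)
    show "(\<lambda>j. 2 * (f1 j * f2 j) + 2 * (f2 j)\<^sup>2) summable_on {1..}"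
      using s(2) summable_on_product_if_in_l2[OF l2(2,3)] by (intro summable_on_add summable_on_cmult_right)
    show "(\<lambda>j. (f2 j)\<^sup>2 + \<eta> * (g j)\<^sup>2 + (if j \<in> ?K then (f2 j)\<^sup>2 / \<eta> else 0) + (if j \<in> ?T then (g j)\<^sup>2 else 0)) summable_on {1..}"
      by (intro summable_on_add summable_on_cmult_right s sK sT)
    fix j :: nat assume j: "j \<in> {1..}"
    have e: "2 * (f1 j * f2 j) + 2 * (f2 j)\<^sup>2 = 2 * (g j * f2 j)"
      by (simp add: dec power2_eq_square algebra_simps)
    show "2 * (f1 j * f2 j) + 2 * (f2 j)\<^sup>2 \<le> (f2 j)\<^sup>2 + \<eta> * (g j)\<^sup>2
        + (if j \<in> ?K then (f2 j)\<^sup>2 / \<eta> else 0) + (if j \<in> ?T then (g j)\<^sup>2 else 0)"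
    proof (cases "real j \<le> c")
      case True
      have "0 \<le> (\<eta> * g j - f2 j)\<^sup>2 / \<eta>" using \<eta> by simp
      also have "\<dots> = \<eta> * (g j)\<^sup>2 + (f2 j)\<^sup>2 / \<eta> - 2 * (g j * f2 j)"
        using \<eta> by (simp add: power2_eq_square field_simps)
      finally have "2 * (g j * f2 j) \<le> \<eta> * (g j)\<^sup>2 + (f2 j)\<^sup>2 / \<eta>" by simp
      moreover have "0 \<le> (f2 j)\<^sup>2" by simp
      ultimately have "2 * (g j * f2 j) \<le> (f2 j)\<^sup>2 + \<eta> * (g j)\<^sup>2 + (f2 j)\<^sup>2 / \<eta>" by linarith
      thus ?thesis unfolding e using True j by simp
    next
      case False
      have "0 \<le> (g j - f2 j)\<^sup>2" by simp
      hence "2 * (g j * f2 j) \<le> (g j)\<^sup>2 + (f2 j)\<^sup>2" by (simp add: power2_diff)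
      moreover have "0 \<le> \<eta> * (g j)\<^sup>2" using \<eta> by simp
      ultimately show ?thesis unfolding e using False j by simp
    qed
  qed
  also have "\<dots> = (\<Sum>\<^sub>\<infinity>j\<in>{1..}. (f2 j)\<^sup>2) + \<eta> * (\<Sum>\<^sub>\<infinity>j\<in>{1..}. (g j)\<^sup>2)
     + (\<Sum>\<^sub>\<infinity>j\<in>?K. (f2 j)\<^sup>2) / \<eta> + (\<Sum>\<^sub>\<infinity>j\<in>?T. (g j)\<^sup>2)"
    unfolding iK[symmetric] iT[symmetric] infsum_cmult_right[OF s(1), symmetric]
    by (simp only: infsum_add[OF summable_on_add[OF summable_on_add[OF s(2) sg] sK] sT]
        infsum_add[OF summable_on_add[OF s(2) sg] sK] infsum_add[OF s(2) sg])
  finally show ?thesis by linarith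
qed

section \<open>Consistency and the size of the signal\<close>

locale quadratic_test =
  fixes \<sigma> r :: real and w :: "nat \<Rightarrow> nat \<Rightarrow> real"
  assumes sigma_pos: "0 < \<sigma>" and r_lt: "r < 1/2"
    and w_nonneg: "\<And>n j. 0 \<le> w n j"
    and w_summable: "\<And>n. n \<ge> 1 \<Longrightarrow> w n summable_on {1..}"
    and A1: "\<And>n i j. n \<ge> 1 \<Longrightarrow> 1 \<le> i \<Longrightarrow> i \<le> j \<Longrightarrow> w n j \<le> w n i"
    and A2: "\<exists>C1 C2. 0 < C1 \<and> (\<forall>n\<ge>1.
               C1 < \<sigma> powr (-4) * (real n)\<^sup>2 * (\<Sum>\<^sub>\<infinity>j\<in>{1..}. (w n j)\<^sup>2) \<and>
               \<sigma> powr (-4) * (real n)\<^sup>2 * (\<Sum>\<^sub>\<infinity>j\<in>{1..}. (w n j)\<^sup>2) < C2)"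
    and A3: "\<exists>c1 c2. 0 < c1 \<and> (\<forall>n\<ge>1.
               c1 * real n powr (-2*r) \<le> rho w n \<and> rho w n \<le> c2 * real n powr (-2*r))"
    and A4: "\<exists>C1 lam. 0 < C1 \<and> 1 < lam \<and> (\<forall>\<delta>>0. \<forall>n\<ge>1.
               w n (nat \<lfloor>(1 + \<delta>) * real (kn w n)\<rfloor>) < C1 * (1 + \<delta>) powr (-lam) * kappa2 w n)"
    and A5a: "\<exists>a b. 0 < a \<and> 0 < b \<and> (\<forall>n\<ge>1. a * kappa2 w n \<le> w n 1 \<and> w n 1 \<le> b * kappa2 w n)"
    and A5b: "\<forall>c::real>1. \<exists>C>0. \<forall>n\<ge>1. w n (nat \<lfloor>c * real (kn w n)\<rfloor>) \<ge> C * kappa2 w n"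
begin

section \<open>Orders of magnitude of the weights and the standardising factor\<close>

lemma w_le_w1: "1 \<le> n \<Longrightarrow> 1 \<le> j \<Longrightarrow> w n j \<le> w n 1"
  by (rule A1) auto

lemma w_sq_summable: "1 \<le> n \<Longrightarrow> (\<lambda>j. (w n j)\<^sup>2) summable_on {1..}"
proof -
  assume n: "1 \<le> n"
  show ?thesis
  proof (rule summable_on_comparison_test)
    show "(\<lambda>j. w n 1 * w n j) summable_on {1..}"
      by (rule summable_on_cmult_right) (rule w_summable[OF n])
  qed (auto simp: power2_eq_square intro!: mult_right_mono w_le_w1[OF n, simplified] w_nonneg)
qed

text \<open>This is A2 after a square root: the null standard deviation has exact order
  \<open>1 / n\<close>.\<close>

lemma null_sd_bounds:
  obtains d1 d2 where "0 < d1" "\<And>n. 1 \<le> n \<Longrightarrow> d1 \<le> real n * null_sd w n"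
    "\<And>n. 1 \<le> n \<Longrightarrow> real n * null_sd w n \<le> d2"
proof -
  from A2 obtain C1 C2 where C: "0 < C1" "\<And>n. 1 \<le> n \<Longrightarrow>
               C1 < \<sigma> powr (-4) * (real n)\<^sup>2 * (\<Sum>\<^sub>\<infinity>j\<in>{1..}. (w n j)\<^sup>2) \<and>
               \<sigma> powr (-4) * (real n)\<^sup>2 * (\<Sum>\<^sub>\<infinity>j\<in>{1..}. (w n j)\<^sup>2) < C2" by blast
  have p4: "\<sigma> powr (-4) = 1 / \<sigma> ^ 4" using sigma_pos by (simp add: powr_minus_divide)
  have eq: "real n * null_sd w n = sqrt (2 * \<sigma> ^ 4 * (\<sigma> powr (-4) * (real n)\<^sup>2 * (\<Sum>\<^sub>\<infinity>j\<in>{1..}. (w n j)\<^sup>2)))" for n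
  proof -
    have "2 * \<sigma> ^ 4 * (\<sigma> powr (-4) * (real n)\<^sup>2 * (\<Sum>\<^sub>\<infinity>j\<in>{1..}. (w n j)\<^sup>2))
       = (real n)\<^sup>2 * (2 * (\<Sum>\<^sub>\<infinity>j\<in>{1..}. (w n j)\<^sup>2))"
      unfolding p4 using sigma_pos by simp
    thus ?thesis unfolding null_sd_def by (simp only: real_sqrt_mult real_sqrt_abs abs_of_nat)
  qed
  have s4: "0 < 2 * \<sigma> ^ 4" using sigma_pos by simp
  show thesis
  proof
    show "0 < sqrt (2 * \<sigma> ^ 4 * C1)" using s4 C(1) by simp
    show "sqrt (2 * \<sigma> ^ 4 * C1) \<le> real n * null_sd w n" if "1 \<le> n" for n
      unfolding eq using s4 C(2)[OF that] by (intro real_sqrt_le_mono mult_left_mono) auto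
    show "real n * null_sd w n \<le> sqrt (2 * \<sigma> ^ 4 * C2)" if "1 \<le> n" for n
      unfolding eq using s4 C(2)[OF that] by (intro real_sqrt_le_mono mult_left_mono) auto
  qed
qed

lemma null_sd_pos: "1 \<le> n \<Longrightarrow> 0 < null_sd w n"
proof -
  assume n: "1 \<le> n"
  obtain d1 d2 where "0 < d1" "\<And>n. 1 \<le> n \<Longrightarrow> d1 \<le> real n * null_sd w n" by (rule null_sd_bounds) blast
  hence "0 < real n * null_sd w n" using n by (meson less_le_trans)
  thus ?thesis using n by (simp add: zero_less_mult_iff)
qed

lemma std_factor_pos: "1 \<le> n \<Longrightarrow> 0 < std_factor \<sigma> w n"
  unfolding std_factor_def using null_sd_pos[of n] sigma_pos by simp

lemma signal_nonneg: "1 \<le> n \<Longrightarrow> 0 \<le> signal \<sigma> w n th"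
  unfolding signal_def using std_factor_pos[of n] w_nonneg
  by (intro mult_nonneg_nonneg infsum_nonneg) auto

lemma rho_pos: "1 \<le> n \<Longrightarrow> 0 < rho w n"
proof -
  assume n: "1 \<le> n"
  from A3 obtain c1 c2 where "0 < c1" "\<And>n. 1 \<le> n \<Longrightarrow> c1 * real n powr (-2*r) \<le> rho w n" by blast
  moreover from this have "0 < c1 * real n powr (-2*r)" using n by simp
  ultimately show ?thesis using n by (meson less_le_trans)
qed

text \<open>Partial sums tend to \<open>rho\<close>, so they exceed half of it from some index on,
  and the supremum defining \<open>kn\<close> is a maximum over a finite nonempty set. Half of
  \<open>rho\<close> is passed exactly when the weight at \<open>kn\<close> is added, so that weight
  is positive.\<close>

lemma kn_properties:
  assumes n: "1 \<le> n"
  shows kn_ge_1: "1 \<le> kn w n"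
    and sum_upto_kn_gt: "rho w n / 2 < (\<Sum>j\<in>{1..kn w n}. w n j)"
    and kappa2_pos: "0 < kappa2 w n"
proof -
  define S where "S = {k. (\<Sum>j\<in>{1..<k}. w n j) \<le> rho w n / 2}"
  have "(\<lambda>N. \<Sum>j<N. w n (Suc j)) \<longlonglongrightarrow> rho w n"
    using infsum_atLeast_Suc_0_sums[OF w_summable[OF n]] unfolding sums_def rho_def .
  hence "\<forall>\<^sub>F N in sequentially. rho w n / 2 < (\<Sum>j<N. w n (Suc j))"
    by (rule order_tendstoD(1)) (use rho_pos[OF n] in simp)
  then obtain N where N: "rho w n / 2 < (\<Sum>j<N. w n (Suc j))"
    using eventually_happens trivial_limit_sequentially by blast
  have sN: "(\<Sum>j<N. w n (Suc j)) = (\<Sum>j\<in>{1..<Suc N}. w n j)"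
    by (rule sum.reindex_bij_witness[where i = "\<lambda>j. j - 1" and j = Suc]) auto
  have "S \<subseteq> {..Suc N}"
  proof
    fix k assume k: "k \<in> S"
    show "k \<in> {..Suc N}"
    proof (rule ccontr)
      assume "k \<notin> {..Suc N}"
      hence "(\<Sum>j\<in>{1..<Suc N}. w n j) \<le> (\<Sum>j\<in>{1..<k}. w n j)"
        by (intro sum_mono2) (auto simp: w_nonneg)
      thus False using k N sN by (simp add: S_def)
    qed
  qed
  hence fin: "finite S" by (rule finite_subset) simp
  have mem: "1 \<in> S" unfolding S_def using rho_pos[OF n] by simp
  have kn: "kn w n = Max S"
    unfolding kn_def S_def[symmetric] using fin mem by (intro cSup_eq_Max) auto
  have knS: "kn w n \<in> S" unfolding kn using fin mem by (intro Max_in) auto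
  show k1: "1 \<le> kn w n" unfolding kn using fin mem by (rule Max_ge)
  \<comment> \<open>Membership concerns the indices strictly below \<open>k\<close>; failure at
    \<open>Suc (kn w n)\<close> thus concerns the sum up to and including
    \<open>kn w n\<close>.\<close>
  have "Suc (kn w n) \<notin> S" unfolding kn using Max_ge[OF fin, of "Suc (Max S)"] by auto
  moreover have "{1..<Suc (kn w n)} = {1..kn w n}" by auto
  ultimately show gt: "rho w n / 2 < (\<Sum>j\<in>{1..kn w n}. w n j)"
    unfolding S_def mem_Collect_eq by (metis not_le)
  have "{1..kn w n} = insert (kn w n) {1..<kn w n}" using k1 by auto
  hence "(\<Sum>j\<in>{1..kn w n}. w n j) = kappa2 w n + (\<Sum>j\<in>{1..<kn w n}. w n j)"
    by (simp add: kappa2_def)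
  thus "0 < kappa2 w n" using gt knS unfolding S_def by simp
qed

text \<open>The weights up to \<open>kn\<close> lie between \<open>kappa2\<close> and
  \<open>b * kappa2\<close> and carry more than half of \<open>rho\<close>. This bounds
  \<open>kn\<close>, and with it the sum of squares, from below. For the upper bound one factor of
  each square is replaced by the largest weight.\<close>

lemma null_sd_sq_bounds:
  assumes n: "1 \<le> n" and b: "w n 1 \<le> b * kappa2 w n"
  shows "kappa2 w n * rho w n \<le> b * (null_sd w n)\<^sup>2"
    and "(null_sd w n)\<^sup>2 \<le> 2 * b * kappa2 w n * rho w n"
proof -
  let ?k = "kn w n" and ?V = "\<Sum>\<^sub>\<infinity>j\<in>{1..}. (w n j)\<^sup>2"
  have b0: "0 \<le> b"
    using b kappa2_pos[OF n] w_nonneg[of n 1] by (smt (verit) mult_neg_pos)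
  have "rho w n / 2 < (\<Sum>j\<in>{1..?k}. w n j)" by (rule sum_upto_kn_gt[OF n])
  also have "\<dots> \<le> (\<Sum>j\<in>{1..?k}. w n 1)" by (intro sum_mono w_le_w1[OF n]) auto
  also have "\<dots> = real ?k * w n 1" by simp
  also have "\<dots> \<le> real ?k * (b * kappa2 w n)" by (intro mult_left_mono b) auto
  finally have 1: "rho w n \<le> 2 * (real ?k * (b * kappa2 w n))" by simp
  have "real ?k * (kappa2 w n)\<^sup>2 = (\<Sum>j\<in>{1..?k}. (kappa2 w n)\<^sup>2)" by simp
  also have "\<dots> \<le> (\<Sum>j\<in>{1..?k}. (w n j)\<^sup>2)"
    using kappa2_pos[OF n] unfolding kappa2_def
    by (intro sum_mono power_mono A1[OF n]) (auto intro: less_imp_le)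
  also have "\<dots> \<le> ?V"
    by (rule finite_sum_le_infsum[OF w_sq_summable[OF n]]) auto
  finally have 2: "real ?k * (kappa2 w n)\<^sup>2 \<le> ?V" .
  have "kappa2 w n * rho w n \<le> kappa2 w n * (2 * (real ?k * (b * kappa2 w n)))"
    using 1 kappa2_pos[OF n] by (intro mult_left_mono) auto
  also have "\<dots> = b * (2 * (real ?k * (kappa2 w n)\<^sup>2))" by (simp add: power2_eq_square)
  also have "\<dots> \<le> b * (2 * ?V)" using 2 b0 by (intro mult_left_mono) auto
  finally show "kappa2 w n * rho w n \<le> b * (null_sd w n)\<^sup>2" unfolding null_sd_sq .
  have "?V \<le> (\<Sum>\<^sub>\<infinity>j\<in>{1..}. w n 1 * w n j)"
    by (intro infsum_mono w_sq_summable[OF n] summable_on_cmult_right w_summable[OF n])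
      (auto simp: power2_eq_square intro!: mult_right_mono w_le_w1[OF n, simplified] w_nonneg)
  also have "\<dots> = w n 1 * rho w n"
    unfolding rho_def by (rule infsum_cmult_right) (rule w_summable[OF n])
  also have "\<dots> \<le> b * kappa2 w n * rho w n"
    using b rho_pos[OF n] by (intro mult_right_mono) auto
  finally show "(null_sd w n)\<^sup>2 \<le> 2 * b * kappa2 w n * rho w n" unfolding null_sd_sq by simp
qed

text \<open>With \<open>D\<close> the null standard deviation, the product is
  \<open>n * D / \<sigma>\<^sup>2\<close> times \<open>kappa2 / D\<^sup>2\<close>. The first factor
  has order 1 by A2. The second has the order of \<open>1 / rho\<close>, since
  \<open>D\<^sup>2\<close> is comparable to \<open>kappa2 * rho\<close>, and A3 makes this
  \<open>n\<^sup>2\<^sup>r\<close>.\<close>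

lemma std_factor_kappa2_bounds:
  obtains u U where "0 < u" "0 < U" "\<And>n. 1 \<le> n \<Longrightarrow> u * real n powr (2*r) \<le> std_factor \<sigma> w n * kappa2 w n"
    "\<And>n. 1 \<le> n \<Longrightarrow> std_factor \<sigma> w n * kappa2 w n \<le> U * real n powr (2*r)"
proof -
  obtain d1 d2 where d: "0 < d1" "\<And>n. 1 \<le> n \<Longrightarrow> d1 \<le> real n * null_sd w n"
    "\<And>n. 1 \<le> n \<Longrightarrow> real n * null_sd w n \<le> d2" by (rule null_sd_bounds) blast
  from A3 obtain c1 c2 where c: "0 < c1" "\<And>n. 1 \<le> n \<Longrightarrow> c1 * real n powr (-2*r) \<le> rho w n"
     "\<And>n. 1 \<le> n \<Longrightarrow> rho w n \<le> c2 * real n powr (-2*r)" by blast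
  from A5a obtain b where b: "0 < b" "\<And>n. 1 \<le> n \<Longrightarrow> w n 1 \<le> b * kappa2 w n" by blast
  \<comment> \<open>The upper constants come without a sign; their positivity is read off at
    \<open>n = 1\<close>.\<close>
  have d20: "0 < d2" using d(1) d(2)[of 1] d(3)[of 1] by simp
  have c20: "0 < c2" using c(1) c(2)[of 1] c(3)[of 1] by simp
  have main: "d1 / (2 * b * \<sigma>\<^sup>2 * c2) * real n powr (2*r) \<le> std_factor \<sigma> w n * kappa2 w n \<and>
      std_factor \<sigma> w n * kappa2 w n \<le> b * d2 / (\<sigma>\<^sup>2 * c1) * real n powr (2*r)" if n: "1 \<le> n" for n
  proof -
    define D where "D = null_sd w n"
    define k where "k = kappa2 w n"
    define R where "R = rho w n"
    define p where "p = real n powr (2*r)"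
    have D: "0 < D" unfolding D_def by (rule null_sd_pos[OF n])
    have R: "0 < R" unfolding R_def by (rule rho_pos[OF n])
    have p: "0 < p" unfolding p_def using n by simp
    have pm: "real n powr (-2*r) = 1 / p" unfolding p_def by (simp add: powr_minus_divide)
    have R1: "c1 / p \<le> R" and R2: "R \<le> c2 / p" using c(2)[OF n] c(3)[OF n] unfolding pm R_def by simp_all
    have kb: "k * R \<le> b * D\<^sup>2" "D\<^sup>2 \<le> 2 * b * k * R"
      unfolding k_def R_def D_def using null_sd_sq_bounds[OF n b(2)[OF n]] by auto
    have q: "std_factor \<sigma> w n * k = real n * D / \<sigma>\<^sup>2 * (k / D\<^sup>2)"
      unfolding std_factor_def D_def[symmetric] using D by (simp add: power2_eq_square)
    have k1: "k / D\<^sup>2 \<le> b / R" using kb(1) D R by (simp add: field_simps)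
    have k2: "1 / (2 * b * R) \<le> k / D\<^sup>2" using kb(2) D R b(1) by (simp add: field_simps)
    have "b / R \<le> b / (c1 / p)" using R1 R p c(1) b(1) by (intro divide_left_mono) auto
    with k1 have k3: "k / D\<^sup>2 \<le> b * p / c1" by simp
    have "1 / (2 * b * (c2 / p)) \<le> 1 / (2 * b * R)"
      using R2 R p c20 b(1) by (intro divide_left_mono mult_left_mono) auto
    moreover have "1 / (2 * b * (c2 / p)) = p / (2 * b * c2)" by simp
    ultimately have k4: "p / (2 * b * c2) \<le> k / D\<^sup>2" using k2 by linarith
    have nD: "d1 \<le> real n * D" "real n * D \<le> d2" unfolding D_def using d n by auto
    have "d1 / \<sigma>\<^sup>2 * (p / (2 * b * c2)) \<le> real n * D / \<sigma>\<^sup>2 * (k / D\<^sup>2)"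
      using nD(1) k4 d(1) b(1) c20 p D by (intro mult_mono divide_right_mono) auto
    moreover have "real n * D / \<sigma>\<^sup>2 * (k / D\<^sup>2) \<le> d2 / \<sigma>\<^sup>2 * (b * p / c1)"
    proof (intro mult_mono divide_right_mono nD(2) k3)
      show "0 \<le> k / D\<^sup>2" unfolding k_def using kappa2_pos[OF n] by simp
      show "0 \<le> d2 / \<sigma>\<^sup>2" using d20 by simp
    qed simp
    ultimately show ?thesis unfolding p_def[symmetric] k_def[symmetric] q by (simp add: mult_ac)
  qed
  show thesis
  proof
    show "0 < d1 / (2 * b * \<sigma>\<^sup>2 * c2)" using d(1) b(1) sigma_pos c20 by simp
    show "0 < b * d2 / (\<sigma>\<^sup>2 * c1)" using d20 b(1) sigma_pos c(1) by simp
  qed (use main in auto)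
qed

text \<open>With \<open>D\<close> the null standard deviation and \<open>w\<^sub>1\<close> the first
  weight, the square is \<open>w\<^sub>1 * (w\<^sub>1 / D\<^sup>2)\<close>. Here
  \<open>w\<^sub>1 \<le> D\<close>, which has order \<open>1 / n\<close>, and the other factor has
  order at most \<open>1 / rho\<close>. So the square has order at most
  \<open>n\<^sup>2\<^sup>r\<^sup>-\<^sup>1\<close>, and \<open>r < 1/2\<close>.\<close>

lemma max_weight_tendsto_0: "max_weight w \<longlonglongrightarrow> 0"
proof -
  obtain d1 d2 where d: "0 < d1" "\<And>n. 1 \<le> n \<Longrightarrow> d1 \<le> real n * null_sd w n"
    "\<And>n. 1 \<le> n \<Longrightarrow> real n * null_sd w n \<le> d2" by (rule null_sd_bounds) blast
  from A3 obtain c1 where c: "0 < c1" "\<And>n. 1 \<le> n \<Longrightarrow> c1 * real n powr (-2*r) \<le> rho w n" by blast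
  from A5a obtain b where b: "0 < b" "\<And>n. 1 \<le> n \<Longrightarrow> w n 1 \<le> b * kappa2 w n" by blast
  define B where "B = b\<^sup>2 * d2 / c1"
  have bd: "(max_weight w n)\<^sup>2 \<le> B * real n powr (2*r - 1)" if n: "1 \<le> n" for n
  proof -
    define D where "D = null_sd w n"
    have D: "0 < D" unfolding D_def by (rule null_sd_pos[OF n])
    have R: "0 < rho w n" by (rule rho_pos[OF n])
    have w0: "0 \<le> w n 1" by (rule w_nonneg)
    have "(w n 1)\<^sup>2 \<le> (\<Sum>\<^sub>\<infinity>j\<in>{1..}. (w n j)\<^sup>2)"
      using finite_sum_le_infsum[OF w_sq_summable[OF n], of "{1}"] by simp
    also have "\<dots> \<le> D\<^sup>2" unfolding D_def null_sd_sq by (simp add: infsum_nonneg)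
    finally have w1: "w n 1 \<le> D" using D by (simp add: power2_le_iff_abs_le)
    have "w n 1 * rho w n \<le> b * kappa2 w n * rho w n" using b(2)[OF n] R by (intro mult_right_mono) auto
    also have "\<dots> \<le> b * (b * D\<^sup>2)"
      unfolding D_def mult.assoc using null_sd_sq_bounds(1)[OF n b(2)[OF n]] b(1) by (intro mult_left_mono) auto
    finally have "w n 1 * rho w n \<le> b\<^sup>2 * D\<^sup>2" by (simp add: power2_eq_square)
    hence w2: "w n 1 / D\<^sup>2 \<le> b\<^sup>2 / rho w n" using D R by (simp add: field_simps)
    have "(max_weight w n)\<^sup>2 = w n 1 * (w n 1 / D\<^sup>2)"
      unfolding max_weight_def D_def by (simp add: power2_eq_square)
    also have "\<dots> \<le> D * (b\<^sup>2 / rho w n)" using w1 w2 w0 D R by (intro mult_mono) auto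
    also have "\<dots> \<le> d2 / real n * (b\<^sup>2 / (c1 * real n powr (-2*r)))"
    proof (rule mult_mono)
      show "D \<le> d2 / real n" using d(3)[OF n] n by (simp add: D_def field_simps)
      show "b\<^sup>2 / rho w n \<le> b\<^sup>2 / (c1 * real n powr (-2*r))"
        using c(2)[OF n] c(1) n R by (intro divide_left_mono mult_pos_pos) auto
      show "0 \<le> d2 / real n" using d(1) d(2)[OF n] d(3)[OF n] by simp
      show "0 \<le> b\<^sup>2 / rho w n" using R by simp
    qed
    also have "\<dots> = B * (real n powr (2*r) / real n)"
      unfolding B_def using n c(1) by (simp add: powr_minus field_simps)
    also have "real n powr (2*r) / real n = real n powr (2*r - 1)"
      using n by (simp add: powr_diff)
    finally show ?thesis .
  qed
  have "(\<lambda>n. (max_weight w n)\<^sup>2) \<longlonglongrightarrow> 0"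
  proof (rule tendsto_sandwich[where f = "\<lambda>_. 0"])
    show "\<forall>\<^sub>F n in sequentially. (max_weight w n)\<^sup>2 \<le> B * real n powr (2*r - 1)"
      using eventually_ge_at_top[of 1] by eventually_elim (rule bd)
    have "(\<lambda>n. real n powr (2*r - 1)) \<longlonglongrightarrow> 0"
      using r_lt by (intro tendsto_neg_powr filterlim_real_sequentially) simp
    thus "(\<lambda>n. B * real n powr (2*r - 1)) \<longlonglongrightarrow> 0" by (rule tendsto_mult_right_zero)
  qed auto
  thus ?thesis by simp
qed

section \<open>Limits of the signal and of the error probabilities\<close>

lemma null_cdf_lim: "(\<lambda>n. null_cdf \<sigma> w n x) \<longlonglongrightarrow> Phi x"
  by (rule null_cdf_tendsto_Phi[OF sigma_pos w_nonneg null_sd_pos w_summable w_sq_summable w_le_w1 max_weight_tendsto_0])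

lemmas beta_le = beta_err_le[OF sigma_pos _ null_sd_pos w_nonneg w_summable w_le_w1]
lemmas beta_ge = beta_err_ge[OF sigma_pos _ null_sd_pos w_nonneg w_summable w_le_w1]
lemmas alpha_eq = alpha_err_eq_null_cdf[OF std_factor_pos w_nonneg]

text \<open>Asymptotic size \<open>a\<close> keeps the rescaled threshold eventually below
  \<open>z + h\<close>, where \<open>z\<close> is the normal quantile of \<open>1 - a\<close>. The
  signal shifts the argument down by \<open>\<delta> / 2\<close>, which brings the type II error
  strictly below \<open>1 - a\<close> in the limit.\<close>

lemma consistent_if_signal_bounded_below:
  assumes l2: "\<And>n. 1 \<le> n \<Longrightarrow> in_l2 (g n)" and \<delta>: "0 < \<delta>"
    and sg: "\<forall>\<^sub>F n in sequentially. \<delta> \<le> signal \<sigma> w n (g n)"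
  shows "consistent \<sigma> w id g"
  unfolding consistent_def
proof (intro allI impI)
  fix a :: real and t :: "nat \<Rightarrow> real"
  assume a: "0 < a \<and> a < 1" and lim: "(\<lambda>i. alpha_err \<sigma> w (id i) (t i) / a) \<longlonglongrightarrow> 1"
  obtain z where z: "Phi z = 1 - a" using Phi_quantile[of "1 - a"] a by auto
  \<comment> \<open>With this choice \<open>z + h - \<delta> / 2 = z - 3 * h\<close>.\<close>
  define h where "h = \<delta> / 8"
  have h: "0 < h" using \<delta> by (simp add: h_def)
  have "(\<lambda>i. alpha_err \<sigma> w i (t i) / a * a) \<longlonglongrightarrow> 1 * a" using lim by (intro tendsto_mult) auto
  hence la: "(\<lambda>i. 1 - alpha_err \<sigma> w i (t i)) \<longlonglongrightarrow> 1 - a" using a by (intro tendsto_diff) auto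
  \<comment> \<open>The intermediate levels \<open>m\<close> and \<open>v\<close> leave margins:
    bounds on a limit superior are only weak, and the last one has to be strictly below
    \<open>1 - a\<close>.\<close>
  define m where "m = (Phi z + Phi (z + h)) / 2"
  have m: "1 - a < m" "m < Phi (z + h)" unfolding m_def z[symmetric] using Phi_strict_mono[of z "z + h"] h by auto
  define v where "v = (Phi (z - 3 * h) + (1 - a)) / 2"
  have v: "Phi (z - 3 * h) < v" "v < 1 - a"
    unfolding v_def z[symmetric] using Phi_strict_mono[of "z - 3 * h" z] h by auto
  have "(\<lambda>n. null_cdf \<sigma> w n (z - 3 * h) + 16 / \<delta> * max_weight w n) \<longlonglongrightarrow> Phi (z - 3 * h) + 16 / \<delta> * 0"
    by (intro tendsto_intros null_cdf_lim max_weight_tendsto_0)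
  hence ev1: "\<forall>\<^sub>F n in sequentially. null_cdf \<sigma> w n (z - 3 * h) + 16 / \<delta> * max_weight w n < v"
    using v(1) by (intro order_tendstoD(2)) auto
  have ev2: "\<forall>\<^sub>F n in sequentially. m < null_cdf \<sigma> w n (z + h)"
    using order_tendstoD(1)[OF null_cdf_lim m(2)] .
  have ev3: "\<forall>\<^sub>F n in sequentially. 1 - alpha_err \<sigma> w n (t n) < m"
    using order_tendstoD(2)[OF la m(1)] .
  have "\<forall>\<^sub>F n in sequentially. ereal (beta_err \<sigma> w n (t n) (g n)) \<le> ereal v"
    using ev1 ev2 ev3 sg eventually_ge_at_top[of 1]
  proof eventually_elim
    case (elim n)
    \<comment> \<open>At \<open>z + h\<close> the null distribution function exceeds
      \<open>m\<close>, at the rescaled threshold it is below \<open>m\<close>; monotonicity orders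
      the arguments.\<close>
    have "null_cdf \<sigma> w n (std_factor \<sigma> w n * t n) < null_cdf \<sigma> w n (z + h)"
      using elim alpha_eq[of n "t n"] by simp
    hence qt: "std_factor \<sigma> w n * t n < z + h"
      using null_cdf_mono[of w n "z + h" "std_factor \<sigma> w n * t n" \<sigma>] w_nonneg by force
    have "beta_err \<sigma> w n (t n) (g n) \<le> null_cdf \<sigma> w n (std_factor \<sigma> w n * t n - \<delta> / 2) + 16 * max_weight w n / \<delta>"
      using elim l2[of n] \<delta> by (intro beta_le) auto
    also have "null_cdf \<sigma> w n (std_factor \<sigma> w n * t n - \<delta> / 2) \<le> null_cdf \<sigma> w n (z - 3 * h)"
      using qt by (intro null_cdf_mono w_nonneg) (simp add: h_def)
    finally show ?case using elim by simp
  qed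
  hence "limsup (\<lambda>n. ereal (beta_err \<sigma> w n (t n) (g n))) \<le> ereal v"
    by (rule Limsup_bounded)
  also have "ereal v < ereal (1 - a)" using v(2) by simp
  finally show "limsup (\<lambda>i. ereal (beta_err \<sigma> w (id i) (t i) (g i))) < ereal (1 - a)" by simp
qed

text \<open>The thresholds are arbitrary, so the estimate must be uniform in them. Uniform
  convergence replaces the null distribution function by \<open>Phi\<close>, for which the shift of
  the argument caused by the alternative costs at most its length.\<close>

lemma inconsistent_if_signal_tendsto_0:
  assumes s: "strict_mono s" and l2: "\<And>i. in_l2 (g i)"
    and sg: "(\<lambda>i. signal \<sigma> w (s i) (g i)) \<longlonglongrightarrow> 0"
  shows "inconsistent \<sigma> w s g"
  unfolding inconsistent_def
proof (intro allI)
  fix t :: "nat \<Rightarrow> real"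
  have sub: "filterlim s at_top sequentially" by (rule filterlim_subseq[OF s])
  let ?X = "\<lambda>i. alpha_err \<sigma> w (s i) (t i) + beta_err \<sigma> w (s i) (t i) (g i)"
  have key: "1 \<le> liminf (\<lambda>i. ereal (?X i)) + ereal e" if e: "0 < e" for e
  proof -
    \<comment> \<open>The losses are \<open>h\<close> for each of two replacements by
      \<open>Phi\<close>, \<open>2 * h\<close> for the shift and \<open>h\<close> for the Chebyshev
      term: \<open>5 * h\<close> in all, below \<open>e\<close>.\<close>
    define h where "h = e / 8"
    have h: "0 < h" using e by (simp add: h_def)
    have nn: "0 \<le> null_cdf \<sigma> w n x" "null_cdf \<sigma> w n x \<le> 1" for n x
      unfolding null_cdf_def by auto
    have "\<forall>\<^sub>F n in sequentially. \<forall>x. \<bar>null_cdf \<sigma> w n x - Phi x\<bar> \<le> h"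
      by (intro cdf_tendsto_Phi_uniformly null_cdf_mono w_nonneg nn null_cdf_lim h)
    hence ev1: "\<forall>\<^sub>F i in sequentially. \<forall>x. \<bar>null_cdf \<sigma> w (s i) x - Phi x\<bar> \<le> h"
      by (rule eventually_compose_filterlim[OF _ sub])
    have "(\<lambda>n. 4 / h * max_weight w n) \<longlonglongrightarrow> 0"
      by (rule tendsto_mult_right_zero[OF max_weight_tendsto_0])
    hence "\<forall>\<^sub>F n in sequentially. 4 / h * max_weight w n < h" using h by (rule order_tendstoD(2))
    hence ev2: "\<forall>\<^sub>F i in sequentially. 4 / h * max_weight w (s i) < h"
      by (rule eventually_compose_filterlim[OF _ sub])
    have ev3: "\<forall>\<^sub>F i in sequentially. signal \<sigma> w (s i) (g i) < h"
      using order_tendstoD(2)[OF sg h] .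
    have ev4: "\<forall>\<^sub>F i in sequentially. 1 \<le> s i"
      by (rule eventually_compose_filterlim[OF eventually_ge_at_top sub])
    have "\<forall>\<^sub>F i in sequentially. ereal (1 - e) \<le> ereal (?X i)"
      using ev1 ev2 ev3 ev4
    proof eventually_elim
      case (elim i)
      define x where "x = std_factor \<sigma> w (s i) * t i"
      have "null_cdf \<sigma> w (s i) (x - 2 * h) - 4 * max_weight w (s i) / h \<le> beta_err \<sigma> w (s i) (t i) (g i)"
        unfolding x_def using elim l2[of i] h by (intro beta_ge) auto
      moreover have "alpha_err \<sigma> w (s i) (t i) = 1 - null_cdf \<sigma> w (s i) x"
        unfolding x_def using elim by (intro alpha_eq) auto
      moreover have "\<bar>null_cdf \<sigma> w (s i) x - Phi x\<bar> \<le> h" "\<bar>null_cdf \<sigma> w (s i) (x - 2 * h) - Phi (x - 2 * h)\<bar> \<le> h"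
        using elim(1) by auto
      moreover have "Phi x - Phi (x - 2 * h) \<le> 2 * h" using Phi_diff_le[of "x - 2 * h" x] h by simp
      moreover have "4 * max_weight w (s i) / h < h" using elim(2) by simp
      ultimately show ?case unfolding ereal_less_eq h_def by linarith
    qed
    hence "ereal (1 - e) \<le> liminf (\<lambda>i. ereal (?X i))" by (rule Liminf_bounded)
    hence "ereal (1 - e) + ereal e \<le> liminf (\<lambda>i. ereal (?X i)) + ereal e" by (rule add_right_mono)
    thus ?thesis by (simp add: one_ereal_def)
  qed
  show "1 \<le> liminf (\<lambda>i. ereal (?X i))" by (rule ereal_le_epsilon2) (use key in blast)
qed

text \<open>Tests with threshold 0 are enough. Where the signal is at least \<open>\<delta>\<close>,
  the shift from 0 to \<open>- \<delta> / 2\<close> brings the error sum below 1 by almost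
  \<open>Phi 0 - Phi (- \<delta> / 2)\<close>; inconsistency excludes this for all large
  \<open>i\<close>.\<close>

lemma signal_tendsto_0_if_inconsistent:
  assumes s: "strict_mono s" and l2: "\<And>i. in_l2 (g i)" and inc: "inconsistent \<sigma> w s g"
  shows "(\<lambda>i. signal \<sigma> w (s i) (g i)) \<longlonglongrightarrow> 0"
proof -
  have sub: "filterlim s at_top sequentially" by (rule filterlim_subseq[OF s])
  have ev4: "\<forall>\<^sub>F i in sequentially. 1 \<le> s i"
    by (rule eventually_compose_filterlim[OF eventually_ge_at_top sub])
  show ?thesis
  proof (rule order_tendstoI)
    fix \<delta> :: real assume \<delta>: "0 < \<delta>"
    define G where "G = Phi 0 - Phi (- \<delta> / 2)"
    have G: "0 < G" unfolding G_def using Phi_strict_mono[of "- \<delta> / 2" 0] \<delta> by simp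
    have "(\<lambda>n. null_cdf \<sigma> w n 0 - null_cdf \<sigma> w n (- \<delta> / 2) - 16 / \<delta> * max_weight w n)
        \<longlonglongrightarrow> Phi 0 - Phi (- \<delta> / 2) - 16 / \<delta> * 0"
      by (intro tendsto_intros null_cdf_lim max_weight_tendsto_0)
    hence "\<forall>\<^sub>F n in sequentially. G / 2 < null_cdf \<sigma> w n 0 - null_cdf \<sigma> w n (- \<delta> / 2) - 16 / \<delta> * max_weight w n"
      using G by (intro order_tendstoD(1)) (auto simp: G_def)
    hence ev1: "\<forall>\<^sub>F i in sequentially. G / 2 < null_cdf \<sigma> w (s i) 0 - null_cdf \<sigma> w (s i) (- \<delta> / 2) - 16 / \<delta> * max_weight w (s i)"
      by (rule eventually_compose_filterlim[OF _ sub])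
    have "1 \<le> liminf (\<lambda>i. ereal (alpha_err \<sigma> w (s i) 0 + beta_err \<sigma> w (s i) 0 (g i)))"
      using inc unfolding inconsistent_def by (rule allE[of _ "\<lambda>_. 0"])
    moreover have "ereal (1 - G / 2) < 1" using G by (simp add: one_ereal_def)
    ultimately have ev2: "\<forall>\<^sub>F i in sequentially. ereal (1 - G / 2) < ereal (alpha_err \<sigma> w (s i) 0 + beta_err \<sigma> w (s i) 0 (g i))"
      unfolding le_Liminf_iff by blast
    show "\<forall>\<^sub>F i in sequentially. signal \<sigma> w (s i) (g i) < \<delta>"
      using ev1 ev2 ev4
    proof eventually_elim
      case (elim i)
      show ?case
      proof (rule ccontr)
        assume "\<not> ?case"
        hence "beta_err \<sigma> w (s i) 0 (g i) \<le> null_cdf \<sigma> w (s i) (std_factor \<sigma> w (s i) * 0 - \<delta> / 2) + 16 * max_weight w (s i) / \<delta>"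
          using elim l2[of i] \<delta> by (intro beta_le) auto
        moreover have "alpha_err \<sigma> w (s i) 0 = 1 - null_cdf \<sigma> w (s i) (std_factor \<sigma> w (s i) * 0)"
          using elim by (intro alpha_eq) auto
        ultimately show False using elim by simp
      qed
    qed
  next
    fix \<delta> :: real assume \<delta>: "\<delta> < 0"
    show "\<forall>\<^sub>F i in sequentially. \<delta> < signal \<sigma> w (s i) (g i)"
      using ev4
    proof eventually_elim
      case (elim i)
      show ?case using signal_nonneg[OF elim, of "g i"] \<delta> by linarith
    qed
  qed
qed

section \<open>Standardised weights on both sides of a multiple of \<open>kn\<close>, and the
  resulting signal\<close>

lemma std_factor_weight_le:
  obtains B lam where "0 < B" "0 < lam"
    "\<And>n j C. 1 \<le> n \<Longrightarrow> 1 < C \<Longrightarrow> C * real (kn w n) < real j \<Longrightarrow>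
       std_factor \<sigma> w n * w n j \<le> B * C powr (-lam) * real n powr (2*r)"
proof -
  obtain u U where uU: "0 < u" "0 < U" "\<And>n. 1 \<le> n \<Longrightarrow> u * real n powr (2*r) \<le> std_factor \<sigma> w n * kappa2 w n"
    "\<And>n. 1 \<le> n \<Longrightarrow> std_factor \<sigma> w n * kappa2 w n \<le> U * real n powr (2*r)"
    by (rule std_factor_kappa2_bounds) (rule that; assumption)
  from A4 obtain B lam where B: "0 < B" "1 < lam" "\<And>\<delta> n. 0 < \<delta> \<Longrightarrow> 1 \<le> n \<Longrightarrow>
      w n (nat \<lfloor>(1 + \<delta>) * real (kn w n)\<rfloor>) < B * (1 + \<delta>) powr (-lam) * kappa2 w n" by blast
  show thesis
  proof
    show "0 < U * B" "0 < lam" using uU B by auto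
    fix n j :: nat and C :: real
    assume n: "1 \<le> n" and C: "1 < C" and j: "C * real (kn w n) < real j"
    have k1: "1 \<le> kn w n" by (rule kn_ge_1[OF n])
    have "1 * 1 \<le> C * real (kn w n)" using C k1 by (intro mult_mono) auto
    \<comment> \<open>The rounded index must be at least 1, as A1 says nothing about index
      0.\<close>
    hence "1 \<le> nat \<lfloor>C * real (kn w n)\<rfloor>" by (simp add: le_nat_floor)
    moreover have "nat \<lfloor>C * real (kn w n)\<rfloor> \<le> j" using j by linarith
    ultimately have "w n j \<le> w n (nat \<lfloor>C * real (kn w n)\<rfloor>)" by (rule A1[OF n])
    \<comment> \<open>A4 with \<open>\<delta> = C - 1\<close>.\<close>
    also have "\<dots> \<le> B * C powr (-lam) * kappa2 w n" using B(3)[of "C - 1" n] C n by simp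
    finally have "std_factor \<sigma> w n * w n j \<le> std_factor \<sigma> w n * (B * C powr (-lam) * kappa2 w n)"
      using std_factor_pos[OF n] by (intro mult_left_mono) auto
    also have "\<dots> = B * C powr (-lam) * (std_factor \<sigma> w n * kappa2 w n)" by simp
    also have "\<dots> \<le> B * C powr (-lam) * (U * real n powr (2*r))"
      using uU(4)[OF n] B(1) by (intro mult_left_mono) auto
    finally show "std_factor \<sigma> w n * w n j \<le> U * B * C powr (-lam) * real n powr (2*r)" by (simp add: mult_ac)
  qed
qed

text \<open>Monotonicity reduces this to the index \<open>C * kn\<close> rounded down, where A5
  leaves a fixed share of \<open>kappa2\<close>.\<close>

lemma std_factor_weight_ge:
  assumes C: "1 < C"
  obtains u where "0 < u" "\<And>n j. 1 \<le> n \<Longrightarrow> 1 \<le> j \<Longrightarrow> real j \<le> C * real (kn w n) \<Longrightarrow>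
      u * real n powr (2*r) \<le> std_factor \<sigma> w n * w n j"
proof -
  obtain u U where uU: "0 < u" "0 < U" "\<And>n. 1 \<le> n \<Longrightarrow> u * real n powr (2*r) \<le> std_factor \<sigma> w n * kappa2 w n"
    "\<And>n. 1 \<le> n \<Longrightarrow> std_factor \<sigma> w n * kappa2 w n \<le> U * real n powr (2*r)"
    by (rule std_factor_kappa2_bounds) (rule that; assumption)
  from A5b C obtain c where c: "0 < c" "\<And>n. 1 \<le> n \<Longrightarrow> c * kappa2 w n \<le> w n (nat \<lfloor>C * real (kn w n)\<rfloor>)" by blast
  show thesis
  proof
    show "0 < c * u" using uU c by simp
    fix n j :: nat
    assume n: "1 \<le> n" and j1: "1 \<le> j" and j: "real j \<le> C * real (kn w n)"
    have "j \<le> nat \<lfloor>C * real (kn w n)\<rfloor>" using j by (simp add: le_nat_floor)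
    hence "w n (nat \<lfloor>C * real (kn w n)\<rfloor>) \<le> w n j" by (rule A1[OF n j1])
    hence "c * kappa2 w n \<le> w n j" using c(2)[OF n] by linarith
    hence "std_factor \<sigma> w n * (c * kappa2 w n) \<le> std_factor \<sigma> w n * w n j"
      using std_factor_pos[OF n] by (intro mult_left_mono) auto
    moreover have "c * (u * real n powr (2*r)) \<le> c * (std_factor \<sigma> w n * kappa2 w n)"
      using uU(3)[OF n] c(1) by (intro mult_left_mono) auto
    ultimately show "c * u * real n powr (2*r) \<le> std_factor \<sigma> w n * w n j" by (simp add: mult_ac)
  qed
qed

text \<open>The weight bound is asked only on the support of \<open>th\<close>, so a truncated
  sequence profits from the decay of the weights far out.\<close>

lemma signal_le_if_supported_on_tail:
  assumes n: "1 \<le> n" and th: "in_l2 th" and B: "0 \<le> B"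
    and bd: "\<And>j. 1 \<le> j \<Longrightarrow> th j \<noteq> 0 \<Longrightarrow> std_factor \<sigma> w n * w n j \<le> B"
  shows "signal \<sigma> w n th \<le> B * (\<Sum>\<^sub>\<infinity>j\<in>{1..}. (th j)\<^sup>2)"
proof -
  have s1: "(\<lambda>j. w n j * (th j)\<^sup>2) summable_on {1..}"
    by (rule summable_on_weighted_squares[of "w n" "w n 1", OF w_nonneg w_le_w1[OF n] th])
  have "signal \<sigma> w n th = (\<Sum>\<^sub>\<infinity>j\<in>{1..}. std_factor \<sigma> w n * (w n j * (th j)\<^sup>2))"
    unfolding signal_def by (rule infsum_cmult_right[symmetric]) (rule s1)
  also have "\<dots> \<le> (\<Sum>\<^sub>\<infinity>j\<in>{1..}. B * (th j)\<^sup>2)"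
  proof (rule infsum_mono)
    show "(\<lambda>j. std_factor \<sigma> w n * (w n j * (th j)\<^sup>2)) summable_on {1..}" by (rule summable_on_cmult_right[OF s1])
    show "(\<lambda>j. B * (th j)\<^sup>2) summable_on {1..}" using th unfolding in_l2_def by (rule summable_on_cmult_right)
    fix j :: nat assume "j \<in> {1..}"
    thus "std_factor \<sigma> w n * (w n j * (th j)\<^sup>2) \<le> B * (th j)\<^sup>2"
      using mult_right_mono[OF bd[of j], of "(th j)\<^sup>2"] by (cases "th j = 0") (auto simp: mult.assoc)
  qed
  also have "\<dots> = B * (\<Sum>\<^sub>\<infinity>j\<in>{1..}. (th j)\<^sup>2)"
    using th unfolding in_l2_def by (rule infsum_cmult_right)
  finally show ?thesis .
qed

lemma signal_ge_head:
  assumes n: "1 \<le> n" and th: "in_l2 th" and K: "K \<subseteq> {1..}"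
    and bd: "\<And>j. j \<in> K \<Longrightarrow> B \<le> std_factor \<sigma> w n * w n j"
  shows "B * (\<Sum>\<^sub>\<infinity>j\<in>K. (th j)\<^sup>2) \<le> signal \<sigma> w n th"
proof -
  have s1: "(\<lambda>j. w n j * (th j)\<^sup>2) summable_on {1..}"
    by (rule summable_on_weighted_squares[of "w n" "w n 1", OF w_nonneg w_le_w1[OF n] th])
  have sK: "(\<lambda>j. (th j)\<^sup>2) summable_on K"
    using th K unfolding in_l2_def by (rule summable_on_subset_banach)
  have "B * (\<Sum>\<^sub>\<infinity>j\<in>K. (th j)\<^sup>2) = (\<Sum>\<^sub>\<infinity>j\<in>K. B * (th j)\<^sup>2)"
    by (rule infsum_cmult_right[symmetric]) (rule sK)
  also have "\<dots> \<le> (\<Sum>\<^sub>\<infinity>j\<in>{1..}. std_factor \<sigma> w n * (w n j * (th j)\<^sup>2))"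
  proof (rule infsum_mono_neutral)
    show "(\<lambda>j. B * (th j)\<^sup>2) summable_on K" by (rule summable_on_cmult_right[OF sK])
    show "(\<lambda>j. std_factor \<sigma> w n * (w n j * (th j)\<^sup>2)) summable_on {1..}" by (rule summable_on_cmult_right[OF s1])
    show "B * (th j)\<^sup>2 \<le> std_factor \<sigma> w n * (w n j * (th j)\<^sup>2)" if "j \<in> K \<inter> {1..}" for j
      using mult_right_mono[OF bd[of j], of "(th j)\<^sup>2"] that by (auto simp: mult.assoc)
    show "0 \<le> std_factor \<sigma> w n * (w n j * (th j)\<^sup>2)" for j
      using std_factor_pos[OF n] w_nonneg[of n j] by simp
    show "B * (th j)\<^sup>2 \<le> 0" if "j \<in> K - {1..}" for j using that K by auto
  qed
  also have "\<dots> = signal \<sigma> w n th"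
    unfolding signal_def by (rule infsum_cmult_right) (rule s1)
  finally show ?thesis .
qed

lemma powr_neg_2r: "real n powr (-2*r) = (real n powr (-r))\<^sup>2"
  by (simp add: power2_eq_square flip: powr_add)

lemma powr_2r_cancel: "1 \<le> n \<Longrightarrow> real n powr (2*r) * real n powr (-2*r) = 1"
  by (simp flip: powr_add)

section \<open>Alternatives of order \<open>n\<^sup>-\<^sup>r\<close> and their tails\<close>

context
  fixes f :: "nat \<Rightarrow> nat \<Rightarrow> real" and cf Cf :: real
  assumes f_l2: "\<And>n. n \<ge> 1 \<Longrightarrow> in_l2 (f n)"
    and cf: "0 < cf" "0 < Cf"
    and f_ge: "\<And>n. n \<ge> 1 \<Longrightarrow> cf * real n powr (-r) \<le> l2norm (f n)"
    and f_le: "\<And>n. n \<ge> 1 \<Longrightarrow> l2norm (f n) \<le> Cf * real n powr (-r)"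
begin

lemma f_sq_ge: "1 \<le> n \<Longrightarrow> cf\<^sup>2 * real n powr (-2*r) \<le> (\<Sum>\<^sub>\<infinity>j\<in>{1..}. (f n j)\<^sup>2)"
  unfolding l2norm_sq[symmetric] powr_neg_2r power_mult_distrib[symmetric]
  using f_ge[of n] cf by (intro power_mono) auto

lemma f_sq_le: "1 \<le> n \<Longrightarrow> (\<Sum>\<^sub>\<infinity>j\<in>{1..}. (f n j)\<^sup>2) \<le> Cf\<^sup>2 * real n powr (-2*r)"
  unfolding l2norm_sq[symmetric] powr_neg_2r power_mult_distrib[symmetric]
  using f_le[of n] by (intro power_mono) (auto simp: l2norm_def infsum_nonneg)

text \<open>Step \<open>i\<close> selects a sample size whose tail beyond
  \<open>(i + 2) * kn\<close> is still large. These tails are orthogonal parts of order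
  \<open>n\<^sup>-\<^sup>r\<close>, but the weights they meet are smaller by the factor
  \<open>(i + 2) powr (-lam)\<close>, so their signal tends to 0.\<close>

lemma not_pure_if_tail_not_small:
  assumes \<epsilon>: "0 < \<epsilon>" and big: "\<And>C1 n0. \<exists>n>n0.
        \<epsilon> * real n powr (-2*r) < (\<Sum>\<^sub>\<infinity>j\<in>{j. j \<ge> 1 \<and> real j > C1 * real (kn w n)}. (f n j)\<^sup>2)"
  shows "\<not> purely_rate_consistent \<sigma> w r f"
proof -
  let ?T = "\<lambda>C n. {j::nat. j \<ge> 1 \<and> real j > C * real (kn w n)}"
  \<comment> \<open>The multiple \<open>i + 2\<close> is unbounded and exceeds 1 already at
    \<open>i = 0\<close>, as the bound for tail weights requires.\<close>
  define P where "P i n \<longleftrightarrow> 1 \<le> n \<and> \<epsilon> * real n powr (-2*r) < (\<Sum>\<^sub>\<infinity>j\<in>?T (real i + 2) n. (f n j)\<^sup>2)" for i n :: nat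
  have "\<exists>s. \<forall>i. P i (s i) \<and> s i < s (Suc i)"
  proof (rule dependent_nat_choice)
    show "\<exists>n. P 0 n" using big[of 0 "real 0 + 2"] unfolding P_def by (metis Suc_leI One_nat_def)
    fix x i
    show "\<exists>y. P (Suc i) y \<and> x < y"
      using big[of x "real (Suc i) + 2"] unfolding P_def by (metis Suc_leI One_nat_def gr_zeroI not_less0)
  qed
  then obtain s where s: "\<And>i. P i (s i)" "\<And>i. s i < s (Suc i)" by blast
  have sm: "strict_mono s" using s(2) by (simp add: strict_mono_Suc_iff)
  have s1: "1 \<le> s i" for i using s(1)[of i] by (simp add: P_def)
  define f2 where "f2 i j = (if j \<in> ?T (real i + 2) (s i) then f (s i) j else 0)" for i j
  \<comment> \<open>Disjoint supports give orthogonality. The ignored index 0 goes to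
    \<open>f1\<close>, so the decomposition holds at every index.\<close>
  define f1 where "f1 i j = (if j \<in> ?T (real i + 2) (s i) then 0 else f (s i) j)" for i j
  have fl: "(\<lambda>j. (f (s i) j)\<^sup>2) summable_on {1..}" for i using f_l2[OF s1] by (simp add: in_l2_def)
  have l2: "in_l2 (f1 i)" "in_l2 (f2 i)" for i
    unfolding in_l2_def by (rule summable_on_comparison_test[OF fl[of i]]; simp add: f1_def f2_def)+
  have sq: "(\<Sum>\<^sub>\<infinity>j\<in>{1..}. (f2 i j)\<^sup>2) = (\<Sum>\<^sub>\<infinity>j\<in>?T (real i + 2) (s i). (f (s i) j)\<^sup>2)" for i
    by (rule infsum_cong_neutral) (auto simp: f2_def)
  have sq_le: "(\<Sum>\<^sub>\<infinity>j\<in>{1..}. (f2 i j)\<^sup>2) \<le> Cf\<^sup>2 * real (s i) powr (-2*r)" for i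
  proof -
    have "(\<Sum>\<^sub>\<infinity>j\<in>{1..}. (f2 i j)\<^sup>2) \<le> (\<Sum>\<^sub>\<infinity>j\<in>{1..}. (f (s i) j)\<^sup>2)"
      using l2(2)[of i] fl[of i] unfolding in_l2_def by (intro infsum_mono) (auto simp: f2_def)
    thus ?thesis using f_sq_le[OF s1[of i]] by linarith
  qed
  have norm: "sqrt \<epsilon> * real (s i) powr (-r) < l2norm (f2 i)" for i
  proof -
    have "(sqrt \<epsilon> * real (s i) powr (-r))\<^sup>2 < (l2norm (f2 i))\<^sup>2"
      using s(1)[of i] \<epsilon> unfolding l2norm_sq sq P_def power_mult_distrib powr_neg_2r by simp
    thus ?thesis by (rule power2_less_imp_less) (simp add: l2norm_def infsum_nonneg)
  qed
  obtain B lam where B: "0 < B" "0 < lam"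
    "\<And>n j C. 1 \<le> n \<Longrightarrow> 1 < C \<Longrightarrow> C * real (kn w n) < real j \<Longrightarrow>
       std_factor \<sigma> w n * w n j \<le> B * C powr (-lam) * real n powr (2*r)"
    by (rule std_factor_weight_le) (rule that; assumption)
  have up: "signal \<sigma> w (s i) (f2 i) \<le> B * Cf\<^sup>2 * (real i + 2) powr (-lam)" for i
  proof -
    let ?B = "B * (real i + 2) powr (-lam) * real (s i) powr (2*r)"
    have "signal \<sigma> w (s i) (f2 i) \<le> ?B * (\<Sum>\<^sub>\<infinity>j\<in>{1..}. (f2 i j)\<^sup>2)"
    proof (rule signal_le_if_supported_on_tail[OF s1 l2(2)])
      show "0 \<le> ?B" using B(1) by simp
      fix j :: nat assume "f2 i j \<noteq> 0"
      hence "(real i + 2) * real (kn w (s i)) < real j" by (simp add: f2_def split: if_splits)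
      thus "std_factor \<sigma> w (s i) * w (s i) j \<le> ?B" by (intro B(3) s1) auto
    qed
    also have "\<dots> \<le> ?B * (Cf\<^sup>2 * real (s i) powr (-2*r))"
      using B(1) by (intro mult_left_mono sq_le) auto
    also have "\<dots> = B * Cf\<^sup>2 * (real i + 2) powr (-lam) * (real (s i) powr (2*r) * real (s i) powr (-2*r))"
      by (simp only: mult_ac)
    finally show ?thesis unfolding powr_2r_cancel[OF s1] by simp
  qed
  have "(\<lambda>i. signal \<sigma> w (s i) (f2 i)) \<longlonglongrightarrow> 0"
  proof (rule tendsto_sandwich[where f = "\<lambda>_. 0"])
    have "filterlim (\<lambda>i. 2 + real i) at_top sequentially"
      by (rule filterlim_tendsto_add_at_top[OF tendsto_const filterlim_real_sequentially])
    hence "(\<lambda>i. (2 + real i) powr (-lam)) \<longlonglongrightarrow> 0" using B(2) by (intro tendsto_neg_powr) auto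
    hence "(\<lambda>i. (real i + 2) powr (-lam)) \<longlonglongrightarrow> 0" by (simp add: add.commute)
    thus "(\<lambda>i. B * Cf\<^sup>2 * (real i + 2) powr (-lam)) \<longlonglongrightarrow> 0" by (rule tendsto_mult_right_zero)
  qed (use up signal_nonneg[OF s1] in auto)
  hence "inconsistent \<sigma> w s f2" by (rule inconsistent_if_signal_tendsto_0[OF sm l2(2)])
  moreover have "\<forall>i. in_l2 (f1 i) \<and> in_l2 (f2 i) \<and> (\<forall>j. f (s i) j = f1 i j + f2 i j) \<and>
       (\<Sum>\<^sub>\<infinity>j\<in>{1..}. f1 i j * f2 i j) = 0 \<and> l2norm (f2 i) > sqrt \<epsilon> * real (s i) powr (-r)"
  proof (intro allI conjI l2 norm)
    show "f (s i) j = f1 i j + f2 i j" for i j by (simp add: f1_def f2_def)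
    show "(\<Sum>\<^sub>\<infinity>j\<in>{1..}. f1 i j * f2 i j) = 0" for i by (intro infsum_0) (simp add: f1_def f2_def)
  qed
  moreover have "0 < sqrt \<epsilon>" using \<epsilon> by simp
  ultimately show ?thesis unfolding purely_rate_consistent_def using sm by blast
qed

text \<open>A small tail leaves a fixed share of the norm in the head, where the weights have full
  order, so the signal stays away from 0. An inconsistent orthogonal part has vanishing signal,
  hence a negligible head, and then its whole norm is too small.\<close>

lemma pure_if_tail_small:
  assumes tail: "\<And>\<epsilon>. 0 < \<epsilon> \<Longrightarrow> \<exists>C1 n0. \<forall>n>n0.
        (\<Sum>\<^sub>\<infinity>j\<in>{j. j \<ge> 1 \<and> real j > C1 * real (kn w n)}. (f n j)\<^sup>2) \<le> \<epsilon> * real n powr (-2*r)"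
  shows "purely_rate_consistent \<sigma> w r f"
proof -
  let ?T = "\<lambda>C n. {j::nat. j \<ge> 1 \<and> real j > C * real (kn w n)}"
  let ?K = "\<lambda>C n. {j::nat. j \<ge> 1 \<and> real j \<le> C * real (kn w n)}"
  \<comment> \<open>Enlarging the constant shrinks the tail; the lower bound for the weights wants a
    constant above 1.\<close>
  have tail': "\<exists>C>1. \<exists>n0. \<forall>n>n0. (\<Sum>\<^sub>\<infinity>j\<in>?T C n. (f n j)\<^sup>2) \<le> \<epsilon> * real n powr (-2*r)" if \<epsilon>: "0 < \<epsilon>" for \<epsilon>
  proof -
    from tail[OF \<epsilon>] obtain C1 n0 where C1: "\<And>n. n > n0 \<Longrightarrow> (\<Sum>\<^sub>\<infinity>j\<in>?T C1 n. (f n j)\<^sup>2) \<le> \<epsilon> * real n powr (-2*r)" by blast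
    have "(\<Sum>\<^sub>\<infinity>j\<in>?T (max C1 2) n. (f n j)\<^sup>2) \<le> \<epsilon> * real n powr (-2*r)" if n: "n > n0" for n
    proof -
      have n1: "1 \<le> n" using n by simp
      have sub: "?T (max C1 2) n \<subseteq> ?T C1 n"
      proof
        fix j assume "j \<in> ?T (max C1 2) n"
        moreover have "C1 * real (kn w n) \<le> max C1 2 * real (kn w n)" by (intro mult_right_mono) auto
        ultimately show "j \<in> ?T C1 n" by auto
      qed
      have "(\<lambda>j. (f n j)\<^sup>2) summable_on ?T C n" for C
        by (rule summable_on_subset_banach[OF f_l2[OF n1, unfolded in_l2_def]]) auto
      hence "(\<Sum>\<^sub>\<infinity>j\<in>?T (max C1 2) n. (f n j)\<^sup>2) \<le> (\<Sum>\<^sub>\<infinity>j\<in>?T C1 n. (f n j)\<^sup>2)"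
        using sub by (intro infsum_mono_neutral) auto
      thus ?thesis using C1[OF n] by linarith
    qed
    moreover have "1 < max C1 2" by simp
    ultimately show ?thesis by blast
  qed
  have cons: "consistent \<sigma> w id f"
  proof -
    \<comment> \<open>The tail may take at most half of the least squared norm; the other half
      remains in the head.\<close>
    have "0 < cf\<^sup>2 / 2" using cf by simp
    from tail'[OF this] obtain C n0 where C: "1 < C"
      "\<And>n. n > n0 \<Longrightarrow> (\<Sum>\<^sub>\<infinity>j\<in>?T C n. (f n j)\<^sup>2) \<le> cf\<^sup>2 / 2 * real n powr (-2*r)" by blast
    obtain u where u: "0 < u" "\<And>n j. 1 \<le> n \<Longrightarrow> 1 \<le> j \<Longrightarrow> real j \<le> C * real (kn w n) \<Longrightarrow>
      u * real n powr (2*r) \<le> std_factor \<sigma> w n * w n j"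
      by (rule std_factor_weight_ge[OF C(1)]) (rule that; assumption)
    show ?thesis
    proof (rule consistent_if_signal_bounded_below[OF f_l2])
      show "0 < u * (cf\<^sup>2 / 2)" using u cf by simp
      show "\<forall>\<^sub>F n in sequentially. u * (cf\<^sup>2 / 2) \<le> signal \<sigma> w n (f n)"
        using eventually_gt_at_top[of n0]
      proof eventually_elim
        case (elim n)
        have n: "1 \<le> n" using elim by simp
        have "cf\<^sup>2 / 2 * real n powr (-2*r) \<le> (\<Sum>\<^sub>\<infinity>j\<in>?K C n. (f n j)\<^sup>2)"
          using f_sq_ge[OF n] C(2)[OF elim] infsum_head_tail[OF f_l2[OF n], of "C * real (kn w n)"] by simp
        hence "u * real n powr (2*r) * (cf\<^sup>2 / 2 * real n powr (-2*r)) \<le> u * real n powr (2*r) * (\<Sum>\<^sub>\<infinity>j\<in>?K C n. (f n j)\<^sup>2)"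
          using u by (intro mult_left_mono) auto
        also have "\<dots> \<le> signal \<sigma> w n (f n)"
          using u(2)[OF n] by (intro signal_ge_head[OF n f_l2[OF n]]) auto
        also have "u * real n powr (2*r) * (cf\<^sup>2 / 2 * real n powr (-2*r)) = u * (cf\<^sup>2 / 2) * (real n powr (2*r) * real n powr (-2*r))"
          by (simp only: mult_ac)
        finally show ?case unfolding powr_2r_cancel[OF n] by simp
      qed
    qed auto
  qed
  have rate: "rate_consistent \<sigma> w r f"
    unfolding rate_consistent_def
  proof (intro conjI cons exI allI impI)
    \<comment> \<open>The definition asks for strict inequalities, so both constants are relaxed by
      a factor 2.\<close>
    show "0 < cf / 2" using cf by simp
    have "cf \<le> Cf" using f_ge[of 1] f_le[of 1] by simp
    thus "cf / 2 < 2 * Cf" using cf by simp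
    fix n :: nat assume n: "1 \<le> n"
    hence p: "0 < real n powr (-r)" by simp
    have "cf / 2 * real n powr (-r) < cf * real n powr (-r)" "Cf * real n powr (-r) < 2 * Cf * real n powr (-r)"
      using p cf by auto
    thus "cf / 2 * real n powr (-r) < l2norm (f n)" "l2norm (f n) < 2 * Cf * real n powr (-r)"
      using f_ge[OF n] f_le[OF n] by linarith+
  qed
  moreover have False if H: "strict_mono s" "0 < c1"
      "\<And>i. in_l2 (f1 i)" "\<And>i. in_l2 (f2 i)" "\<And>i j. f (s i) j = f1 i j + f2 i j"
      "\<And>i. (\<Sum>\<^sub>\<infinity>j\<in>{1..}. f1 i j * f2 i j) = 0" "\<And>i. l2norm (f2 i) > c1 * real (s i) powr (-r)"
      "inconsistent \<sigma> w s f2" for s c1 f1 f2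
  proof -
    have sub: "filterlim s at_top sequentially" by (rule filterlim_subseq[OF H(1)])
    \<comment> \<open>Each of three terms bounding the squared norm of \<open>f2\<close> is to be at
      most \<open>c1\<^sup>2 / 4 * n\<^sup>-\<^sup>2\<^sup>r\<close>. This \<open>\<eta>\<close>
      achieves it for the term with the norm of \<open>f\<close>; the tail level and the bound on
      the signal below serve the other two.\<close>
    define \<eta> where "\<eta> = c1\<^sup>2 / (4 * Cf\<^sup>2)"
    have \<eta>: "0 < \<eta>" unfolding \<eta>_def using cf H(2) by simp
    have "0 < c1\<^sup>2 / 4" using H(2) by simp
    from tail'[OF this] obtain C n0 where C: "1 < C"
      "\<And>n. n > n0 \<Longrightarrow> (\<Sum>\<^sub>\<infinity>j\<in>?T C n. (f n j)\<^sup>2) \<le> c1\<^sup>2 / 4 * real n powr (-2*r)" by blast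
    obtain u where u: "0 < u" "\<And>n j. 1 \<le> n \<Longrightarrow> 1 \<le> j \<Longrightarrow> real j \<le> C * real (kn w n) \<Longrightarrow>
      u * real n powr (2*r) \<le> std_factor \<sigma> w n * w n j"
      by (rule std_factor_weight_ge[OF C(1)]) (rule that; assumption)
    have "(\<lambda>i. signal \<sigma> w (s i) (f2 i)) \<longlonglongrightarrow> 0"
      by (rule signal_tendsto_0_if_inconsistent[OF H(1,4,8)])
    moreover have "0 < u * (\<eta> * (c1\<^sup>2 / 4))" using u \<eta> H(2) by simp
    ultimately have ev1: "\<forall>\<^sub>F i in sequentially. signal \<sigma> w (s i) (f2 i) < u * (\<eta> * (c1\<^sup>2 / 4))"
      by (rule order_tendstoD(2))
    have ev2: "\<forall>\<^sub>F i in sequentially. n0 < s i"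
      by (rule eventually_compose_filterlim[OF eventually_gt_at_top sub])
    obtain i where i: "signal \<sigma> w (s i) (f2 i) < u * (\<eta> * (c1\<^sup>2 / 4))" "n0 < s i"
      using eventually_happens[OF eventually_conj[OF ev1 ev2]] by auto
    define n where "n = s i"
    define p where "p = real n powr (-2*r)"
    have n: "1 \<le> n" using i(2) by (simp add: n_def)
    have p: "0 < p" unfolding p_def using n by simp
    have qp: "real n powr (2*r) = 1 / p" using powr_2r_cancel[OF n] p by (simp add: p_def field_simps)
    have "u * real n powr (2*r) * (\<Sum>\<^sub>\<infinity>j\<in>?K C n. (f2 i j)\<^sup>2) \<le> signal \<sigma> w n (f2 i)"
      using u(2)[OF n] by (intro signal_ge_head[OF n H(4)]) auto
    also have "\<dots> < u * (\<eta> * (c1\<^sup>2 / 4))" using i(1) by (simp add: n_def)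
    finally have "u * ((\<Sum>\<^sub>\<infinity>j\<in>?K C n. (f2 i j)\<^sup>2) / p) < u * (\<eta> * (c1\<^sup>2 / 4))" by (simp add: qp)
    hence "(\<Sum>\<^sub>\<infinity>j\<in>?K C n. (f2 i j)\<^sup>2) / p < \<eta> * (c1\<^sup>2 / 4)"
      unfolding mult_less_cancel_left_pos[OF u(1)] .
    hence h: "(\<Sum>\<^sub>\<infinity>j\<in>?K C n. (f2 i j)\<^sup>2) / \<eta> \<le> c1\<^sup>2 / 4 * p" using p \<eta> by (simp add: field_simps)
    have "\<eta> * (\<Sum>\<^sub>\<infinity>j\<in>{1..}. (f n j)\<^sup>2) \<le> \<eta> * (Cf\<^sup>2 * p)"
      using f_sq_le[OF n] \<eta> unfolding p_def by (intro mult_left_mono) auto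
    also have "\<dots> = c1\<^sup>2 / 4 * p" unfolding \<eta>_def using cf by simp
    finally have g: "\<eta> * (\<Sum>\<^sub>\<infinity>j\<in>{1..}. (f n j)\<^sup>2) \<le> c1\<^sup>2 / 4 * p" .
    have t: "(\<Sum>\<^sub>\<infinity>j\<in>?T C n. (f n j)\<^sup>2) \<le> c1\<^sup>2 / 4 * p" using C(2)[OF i(2)] by (simp add: n_def p_def)
    have "(c1 * real n powr (-r))\<^sup>2 < (l2norm (f2 i))\<^sup>2"
      using H(2) H(7)[of i] by (intro power_strict_mono) (auto simp: n_def)
    hence "c1\<^sup>2 * p < (\<Sum>\<^sub>\<infinity>j\<in>{1..}. (f2 i j)\<^sup>2)"
      unfolding l2norm_sq power_mult_distrib p_def powr_neg_2r .
    also have "\<dots> \<le> \<eta> * (\<Sum>\<^sub>\<infinity>j\<in>{1..}. (f n j)\<^sup>2) + (\<Sum>\<^sub>\<infinity>j\<in>?K C n. (f2 i j)\<^sup>2) / \<eta> + (\<Sum>\<^sub>\<infinity>j\<in>?T C n. (f n j)\<^sup>2)"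
      using H(5)[of i] by (intro orthogonal_part_norm_le[OF f_l2[OF n] H(3,4) _ H(6) \<eta>]) (simp add: n_def)
    also have "\<dots> \<le> c1\<^sup>2 / 4 * p + c1\<^sup>2 / 4 * p + c1\<^sup>2 / 4 * p" using g h t by linarith
    \<comment> \<open>A single late index suffices: three quarters fall short of the squared norm
      that \<open>f2\<close> has there.\<close>
    finally have "c1\<^sup>2 * p < 3 / 4 * (c1\<^sup>2 * p)" by simp
    moreover have "0 < c1\<^sup>2 * p" using H(2) p by simp
    ultimately show False by linarith
  qed
  ultimately show ?thesis unfolding purely_rate_consistent_def by blast
qed

end

end

theorem theorem10:
  fixes \<sigma> r :: real and w :: "nat \<Rightarrow> nat \<Rightarrow> real" and f :: "nat \<Rightarrow> nat \<Rightarrow> real"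
  assumes sigma_pos: "0 < \<sigma>" and r_pos: "0 < r" and r_lt: "r < 1/2"
    and w_nonneg: "\<And>n j. 0 \<le> w n j"
    and w_summable: "\<And>n. n \<ge> 1 \<Longrightarrow> w n summable_on {1..}"
    and A1: "\<And>n i j. n \<ge> 1 \<Longrightarrow> 1 \<le> i \<Longrightarrow> i \<le> j \<Longrightarrow> w n j \<le> w n i"
    and A2: "\<exists>C1 C2. 0 < C1 \<and> (\<forall>n\<ge>1.
               C1 < \<sigma> powr (-4) * (real n)\<^sup>2 * (\<Sum>\<^sub>\<infinity>j\<in>{1..}. (w n j)\<^sup>2) \<and>
               \<sigma> powr (-4) * (real n)\<^sup>2 * (\<Sum>\<^sub>\<infinity>j\<in>{1..}. (w n j)\<^sup>2) < C2)"
    and A3: "\<exists>c1 c2. 0 < c1 \<and> (\<forall>n\<ge>1.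
               c1 * real n powr (-2*r) \<le> rho w n \<and> rho w n \<le> c2 * real n powr (-2*r))"
    and A4: "\<exists>C1 lam. 0 < C1 \<and> 1 < lam \<and> (\<forall>\<delta>>0. \<forall>n\<ge>1.
               w n (nat \<lfloor>(1 + \<delta>) * real (kn w n)\<rfloor>) < C1 * (1 + \<delta>) powr (-lam) * kappa2 w n)"
    and A5a: "\<exists>a b. 0 < a \<and> 0 < b \<and> (\<forall>n\<ge>1. a * kappa2 w n \<le> w n 1 \<and> w n 1 \<le> b * kappa2 w n)"
    and A5b: "\<forall>c::real>1. \<exists>C>0. \<forall>n\<ge>1. w n (nat \<lfloor>c * real (kn w n)\<rfloor>) \<ge> C * kappa2 w n"
    and f_l2: "\<And>n. n \<ge> 1 \<Longrightarrow> in_l2 (f n)"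
    and f_norm: "\<exists>c C. 0 < c \<and> c < C \<and> (\<forall>n\<ge>1.
               c * real n powr (-r) \<le> l2norm (f n) \<and> l2norm (f n) \<le> C * real n powr (-r))"
  shows "purely_rate_consistent \<sigma> w r f \<longleftrightarrow>
    (\<forall>\<epsilon>>0. \<exists>C1 n0. \<forall>n>n0.
        (\<Sum>\<^sub>\<infinity>j\<in>{j. j \<ge> 1 \<and> real j > C1 * real (kn w n)}. (f n j)\<^sup>2) \<le> \<epsilon> * real n powr (-2*r))"
proof -
  interpret quadratic_test \<sigma> r w
    using sigma_pos r_lt w_nonneg w_summable A1 A2 A3 A4 A5a A5b by (rule quadratic_test.intro)
  from f_norm obtain c C where cC: "0 < c" "c < C"
    "\<And>n. 1 \<le> n \<Longrightarrow> c * real n powr (-r) \<le> l2norm (f n)"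
    "\<And>n. 1 \<le> n \<Longrightarrow> l2norm (f n) \<le> C * real n powr (-r)" by blast
  have C: "0 < C" using cC by linarith
  show ?thesis
  proof (intro iffI allI impI)
    fix \<epsilon> :: real
    assume pure: "purely_rate_consistent \<sigma> w r f" and \<epsilon>: "0 < \<epsilon>"
    show "\<exists>C1 n0. \<forall>n>n0. (\<Sum>\<^sub>\<infinity>j\<in>{j. j \<ge> 1 \<and> real j > C1 * real (kn w n)}. (f n j)\<^sup>2) \<le> \<epsilon> * real n powr (-2*r)"
    proof (rule ccontr)
      assume "\<not> ?thesis"
      hence "\<exists>n>n0. \<epsilon> * real n powr (-2*r) < (\<Sum>\<^sub>\<infinity>j\<in>{j. j \<ge> 1 \<and> real j > C1 * real (kn w n)}. (f n j)\<^sup>2)" for C1 n0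
        by (meson not_le)
      from not_pure_if_tail_not_small[OF f_l2 cC(1) C cC(3,4) \<epsilon> this] pure show False by blast
    qed
  next
    assume "\<forall>\<epsilon>>0. \<exists>C1 n0. \<forall>n>n0.
        (\<Sum>\<^sub>\<infinity>j\<in>{j. j \<ge> 1 \<and> real j > C1 * real (kn w n)}. (f n j)\<^sup>2) \<le> \<epsilon> * real n powr (-2*r)"
    thus "purely_rate_consistent \<sigma> w r f"
      by (intro pure_if_tail_small[OF f_l2 cC(1) C cC(3,4)]) auto
  qed
qed

end
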